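(* Let $G,H$ be Lie groups with Lie algebras $\mathfrak g,\mathfrak h$, let $\Phi:G\to\mathrm{Aut}(H)$ be an action with differentiated action $\phi:\mathfrak g\to\mathrm{Der}(\mathfrak h)$, let $\mathcal B:H\to G$ be a relative Rota-Baxter operator on $G$ with respect to $(H;\Phi)$, and let $B=\mathcal B_{*e_H}:\mathfrak h\to\mathfrak g$. Then the differentiation of the action $\Theta:H\to GL(\mathfrak g)$ of the descendent Lie group $(H,e_H,\star)$ on $\mathfrak g$ is exactly the representation $\theta:\mathfrak h\to\mathfrak{gl}(\mathfrak g)$ of the descendent Lie algebra $(\mathfrak h,[\cdot,\cdot]_B)$ on $\mathfrak g$; that is, $$\Theta_{*e_H}(u)x=B(\phi(x)u)+[B(u),x]_{\mathfrak g},\quad\forall x\in\mathfrak g,\ u\in\mathfrak h.$$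
   Context: Lie groups are real and finite-dimensional. An action of $G$ on $H$ is a group homomorphism $\Phi:G\to\mathrm{Aut}(H)$ into the Lie group automorphisms of $H$ such that $(g,h)\mapsto\Phi(g)h$ is smooth. A relative Rota-Baxter operator on $G$ with respect to $(H;\Phi)$ is a smooth map $\mathcal B:H\to G$ with $\mathcal B(h_1)\cdot_G\mathcal B(h_2)=\mathcal B(h_1\cdot_H\Phi(\mathcal B(h_1))h_2)$ for all $h_1,h_2\in H$. Its descendent Lie group is the manifold $H$ with multiplication $h_1\star h_2=h_1\cdot_H\Phi(\mathcal B(h_1))h_2$, unit $e_H$, inverse $h^\dagger=\Phi(\mathcal B(h)^{-1})h^{-1}$. The descendent Lie group acts on the manifold $G$ by $\Theta(h)g=(\mathcal B(\Phi(g)h^\dagger))^{-1}\cdot_G g\cdot_G\mathcal B(h^\dagger)$; each $\Theta(h)$ fixes $e_G$, and taking tangent maps at $e_G$ gives a Lie group homomorphism from $(H,\star)$ to $GL(\mathfrak g)$, $h\mapsto\Theta(h)_{*e_G}$, again denoted $\Theta:H\to GL(\mathfrak g)$. $\Theta_{*e_H}:\mathfrak h\to\mathfrak{gl}(\mathfrak g)$ is its tangent map at $e_H$. Differentiated action: $\tilde\Phi(g)=\Phi(g)_{*e_H}\in\mathrm{Aut}(\mathfrak h)$, $\phi:=\tilde\Phi_{*e_G}:\mathfrak g\to\mathrm{Der}(\mathfrak h)$. $B=\mathcal B_{*e_H}$ is a relative Rota-Baxter operator of weight $1$ on $\mathfrak g$ with respect to $(\mathfrak h;\phi)$; its descendent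 Lie algebra is $\mathfrak h$ with bracket $[u,v]_B=\phi(B(u))v-\phi(B(v))u+[u,v]_{\mathfrak h}$, which is the Lie algebra of $(H,\star)$ and has the representation $\theta(u)x=B(\phi(x)u)+[B(u),x]_{\mathfrak g}$ on $\mathfrak g$. *)

theory Defs
  imports "HOL-Analysis.Analysis" "HOL-Algebra.Group"
begin

text \<open>
  Model spaces of manifolds: the axioms of \<^class>\<open>euclidean_space\<close> without \<open>Basis \<noteq> {}\<close>, so that
  dimension \<open>0\<close> is allowed.
\<close>

class finite_dim_inner = real_inner +
  assumes finite_orthonormal_basis:
    "\<exists>B. finite B \<and> (\<forall>u\<in>B. \<forall>v\<in>B. inner u v = (if u = v then 1 else 0)) \<and>
         (\<forall>x. (\<forall>u\<in>B. inner x u = 0) \<longleftrightarrow> x = 0)"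

subclass (in euclidean_space) finite_dim_inner
  by unfold_locales (use finite_Basis inner_Basis euclidean_all_zero_iff in blast)


section \<open>Smooth maps between open subsets of finite-dimensional spaces\<close>

text \<open>
  In finite dimension \<open>f\<close> is of class \<open>C\<^sup>k\<^sup>+\<^sup>1\<close> iff it is differentiable and all its directional
  derivatives are of class \<open>C\<^sup>k\<close>. The set \<open>S\<close> is meant to be open.
\<close>

fun Ck_on :: "nat \<Rightarrow> 'a::real_normed_vector set \<Rightarrow> ('a \<Rightarrow> 'b::real_normed_vector) \<Rightarrow> bool" where
  "Ck_on 0 S f \<longleftrightarrow> continuous_on S f"
| "Ck_on (Suc k) S f \<longleftrightarrow>
     (\<forall>x\<in>S. f differentiable (at x)) \<and>
     (\<forall>v. Ck_on k S (\<lambda>x. frechet_derivative f (at x) v))"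

definition smooth_on :: "'a::real_normed_vector set \<Rightarrow> ('a \<Rightarrow> 'b::real_normed_vector) \<Rightarrow> bool" where
  "smooth_on S f \<longleftrightarrow> (\<forall>k. Ck_on k S f)"


section \<open>Manifolds, smooth maps and tangent maps\<close>

text \<open>
  A chart is a pair of its domain and the coordinate map. The underlying set of a manifold is a
  whole type, whose topology is the manifold topology. An atlas need not be maximal.
\<close>

type_synonym ('m, 'e) chart = "'m set \<times> ('m \<Rightarrow> 'e)"

definition chart_inv :: "('m, 'e) chart \<Rightarrow> 'e \<Rightarrow> 'm" where
  "chart_inv c = inv_into (fst c) (snd c)"

definition is_chart :: "('m::topological_space, 'e::real_normed_vector) chart \<Rightarrow> bool" where
  "is_chart c \<longleftrightarrow> open (fst c) \<and> open (snd c ` fst c) \<and>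
     homeomorphism (fst c) (snd c ` fst c) (snd c) (chart_inv c)"

definition smooth_atlas :: "('m::topological_space, 'e::real_normed_vector) chart set \<Rightarrow> bool" where
  "smooth_atlas \<A> \<longleftrightarrow>
     (\<forall>c\<in>\<A>. is_chart c) \<and> (\<Union>c\<in>\<A>. fst c) = UNIV \<and>
     (\<forall>c\<in>\<A>. \<forall>d\<in>\<A>. smooth_on (snd c ` (fst c \<inter> fst d)) (snd d \<circ> chart_inv c))"

definition smooth_map ::
  "('m::topological_space, 'e::real_normed_vector) chart set \<Rightarrow>
   ('n::topological_space, 'f::real_normed_vector) chart set \<Rightarrow> ('m \<Rightarrow> 'n) \<Rightarrow> bool" where
  "smooth_map \<A> \<B> F \<longleftrightarrow> continuous_on UNIV F \<and>
     (\<forall>c\<in>\<A>. \<forall>d\<in>\<B>. smooth_on (snd c ` (fst c \<inter> F -` fst d)) (snd d \<circ> F \<circ> chart_inv c))"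

definition prod_atlas ::
  "('m, 'e) chart set \<Rightarrow> ('n, 'f) chart set \<Rightarrow> ('m \<times> 'n, 'e \<times> 'f) chart set" where
  "prod_atlas \<A> \<B> = {(fst c \<times> fst d, map_prod (snd c) (snd d)) |c d. c \<in> \<A> \<and> d \<in> \<B>}"

text \<open>
  The tangent space at \<open>p\<close> is the model space: a tangent vector is given by its coordinates in the
  chart \<open>chart_at \<A> p\<close> chosen once and for all for the point \<open>p\<close>, and the tangent map of \<open>F\<close> at \<open>p\<close>
  is the derivative of \<open>F\<close> read in the charts chosen at \<open>p\<close> and at \<open>F p\<close>.
\<close>

definition chart_at :: "('m, 'e) chart set \<Rightarrow> 'm \<Rightarrow> ('m, 'e) chart" where
  "chart_at \<A> p = (SOME c. c \<in> \<A> \<and> p \<in> fst c)"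

definition deriv_in_charts ::
  "('m, 'e::real_normed_vector) chart \<Rightarrow> ('n, 'f::real_normed_vector) chart \<Rightarrow>
   ('m \<Rightarrow> 'n) \<Rightarrow> 'm \<Rightarrow> 'e \<Rightarrow> 'f" where
  "deriv_in_charts c d F p = frechet_derivative (snd d \<circ> F \<circ> chart_inv c) (at (snd c p))"

definition tangent_map ::
  "('m, 'e::real_normed_vector) chart set \<Rightarrow> ('n, 'f::real_normed_vector) chart set \<Rightarrow>
   ('m \<Rightarrow> 'n) \<Rightarrow> 'm \<Rightarrow> 'e \<Rightarrow> 'f" where
  "tangent_map \<A> \<B> F p = deriv_in_charts (chart_at \<A> p) (chart_at \<B> (F p)) F p"

text \<open>
  A normed vector space as a manifold over itself. As \<open>GL(V)\<close> is open in the space \<open>gl(V)\<close> of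
  (bounded) linear endomorphisms of \<open>V\<close>, its tangent space at any point is \<open>gl(V)\<close>, and tangent maps
  of maps into \<open>GL(V)\<close> or its closed subgroups are formed in \<open>gl(V)\<close>.
\<close>

definition vec_atlas :: "('v::real_normed_vector, 'v) chart set" where
  "vec_atlas = {(UNIV, id)}"


section \<open>Lie groups and their Lie algebras\<close>

record ('m, 'e) lie_struct = "'m monoid" +
  atlas :: "('m, 'e) chart set"

definition lie_group ::
  "('m::{t2_space,second_countable_topology}, 'e::finite_dim_inner) lie_struct \<Rightarrow> bool" where
  "lie_group G \<longleftrightarrow>
     group G \<and> carrier G = UNIV \<and> smooth_atlas (atlas G) \<and>
     smooth_map (prod_atlas (atlas G) (atlas G)) (atlas G) (\<lambda>(a, b). a \<otimes>\<^bsub>G\<^esub> b) \<and>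
     smooth_map (atlas G) (atlas G) (\<lambda>a. inv\<^bsub>G\<^esub> a)"

text \<open>
  The Lie algebra of \<open>G\<close> is the tangent space at the unit with the bracket of left-invariant
  vector fields. Near the unit, vector fields are read in the chart \<open>c\<close> chosen there:
  \<open>left_inv_field G x q\<close> is the coordinate vector of \<open>(L\<^sub>g)\<^sub>*x\<close> at the point \<open>g\<close> with coordinates \<open>q\<close>.
  The bracket of vector fields satisfies \<open>[X, Y] f = X (Y f) - Y (X f)\<close>, that is,
  \<open>[X, Y] = DY(X) - DX(Y)\<close> in coordinates.
\<close>

definition left_inv_field ::
  "('m, 'e::real_normed_vector) lie_struct \<Rightarrow> 'e \<Rightarrow> 'e \<Rightarrow> 'e" where
  "left_inv_field G x q =
     (let c = chart_at (atlas G) \<one>\<^bsub>G\<^esub>; g = chart_inv c q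
      in deriv_in_charts c c (\<lambda>a. g \<otimes>\<^bsub>G\<^esub> a) \<one>\<^bsub>G\<^esub> x)"

definition vector_field_bracket ::
  "('e::real_normed_vector \<Rightarrow> 'e) \<Rightarrow> ('e \<Rightarrow> 'e) \<Rightarrow> 'e \<Rightarrow> 'e" where
  "vector_field_bracket X Y q =
     frechet_derivative Y (at q) (X q) - frechet_derivative X (at q) (Y q)"

definition lie_bracket :: "('m, 'e::real_normed_vector) lie_struct \<Rightarrow> 'e \<Rightarrow> 'e \<Rightarrow> 'e" where
  "lie_bracket G x y =
     vector_field_bracket (left_inv_field G x) (left_inv_field G y)
       (snd (chart_at (atlas G) \<one>\<^bsub>G\<^esub>) \<one>\<^bsub>G\<^esub>)"


section \<open>Actions and relative Rota-Baxter operators\<close>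

definition lie_aut ::
  "('m::topological_space, 'e::real_normed_vector) lie_struct \<Rightarrow> ('m \<Rightarrow> 'm) monoid" where
  "lie_aut H =
     \<lparr>carrier = {F \<in> iso H H. smooth_map (atlas H) (atlas H) F \<and>
                              smooth_map (atlas H) (atlas H) (inv_into UNIV F)},
      mult = (\<circ>), one = id\<rparr>"

definition lie_action ::
  "('m::topological_space, 'e::real_normed_vector) lie_struct \<Rightarrow>
   ('n::topological_space, 'f::real_normed_vector) lie_struct \<Rightarrow> ('m \<Rightarrow> 'n \<Rightarrow> 'n) \<Rightarrow> bool" where
  "lie_action G H \<Phi> \<longleftrightarrow> \<Phi> \<in> hom G (lie_aut H) \<and>
     smooth_map (prod_atlas (atlas G) (atlas H)) (atlas H) (\<lambda>(g, h). \<Phi> g h)"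

definition rel_rota_baxter ::
  "('m::topological_space, 'e::real_normed_vector) lie_struct \<Rightarrow>
   ('n::topological_space, 'f::real_normed_vector) lie_struct \<Rightarrow>
   ('m \<Rightarrow> 'n \<Rightarrow> 'n) \<Rightarrow> ('n \<Rightarrow> 'm) \<Rightarrow> bool" where
  "rel_rota_baxter G H \<Phi> \<B> \<longleftrightarrow> smooth_map (atlas H) (atlas G) \<B> \<and>
     (\<forall>h1 h2. \<B> h1 \<otimes>\<^bsub>G\<^esub> \<B> h2 = \<B> (h1 \<otimes>\<^bsub>H\<^esub> \<Phi> (\<B> h1) h2))"

text \<open>\<open>aut_deriv H \<Phi> g\<close> is \<open>\<Phi>(g)\<^sub>*\<close> at the unit of \<open>H\<close>, and \<open>diff_action\<close> is its derivative \<open>\<phi>\<close> at the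
  unit of \<open>G\<close>.\<close>

definition aut_deriv ::
  "('n, 'f::real_normed_vector) lie_struct \<Rightarrow> ('m \<Rightarrow> 'n \<Rightarrow> 'n) \<Rightarrow> 'm \<Rightarrow> 'f \<Rightarrow>\<^sub>L 'f" where
  "aut_deriv H \<Phi> g = Blinfun (tangent_map (atlas H) (atlas H) (\<Phi> g) \<one>\<^bsub>H\<^esub>)"

definition diff_action ::
  "('m, 'e::real_normed_vector) lie_struct \<Rightarrow> ('n, 'f::real_normed_vector) lie_struct \<Rightarrow>
   ('m \<Rightarrow> 'n \<Rightarrow> 'n) \<Rightarrow> 'e \<Rightarrow> 'f \<Rightarrow>\<^sub>L 'f" where
  "diff_action G H \<Phi> = tangent_map (atlas G) vec_atlas (aut_deriv H \<Phi>) \<one>\<^bsub>G\<^esub>"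

definition descendent ::
  "('n, 'f) lie_struct \<Rightarrow> ('m \<Rightarrow> 'n \<Rightarrow> 'n) \<Rightarrow> ('n \<Rightarrow> 'm) \<Rightarrow> ('n, 'f) lie_struct" where
  "descendent H \<Phi> \<B> = H\<lparr>mult := \<lambda>h1 h2. h1 \<otimes>\<^bsub>H\<^esub> \<Phi> (\<B> h1) h2\<rparr>"

definition dagger ::
  "('m, 'e) lie_struct \<Rightarrow> ('n, 'f) lie_struct \<Rightarrow> ('m \<Rightarrow> 'n \<Rightarrow> 'n) \<Rightarrow> ('n \<Rightarrow> 'm) \<Rightarrow> 'n \<Rightarrow> 'n" where
  "dagger G H \<Phi> \<B> h = \<Phi> (inv\<^bsub>G\<^esub> (\<B> h)) (inv\<^bsub>H\<^esub> h)"

definition Theta ::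
  "('m, 'e) lie_struct \<Rightarrow> ('n, 'f) lie_struct \<Rightarrow> ('m \<Rightarrow> 'n \<Rightarrow> 'n) \<Rightarrow> ('n \<Rightarrow> 'm) \<Rightarrow>
   'n \<Rightarrow> 'm \<Rightarrow> 'm" where
  "Theta G H \<Phi> \<B> h g =
     inv\<^bsub>G\<^esub> (\<B> (\<Phi> g (dagger G H \<Phi> \<B> h))) \<otimes>\<^bsub>G\<^esub> g \<otimes>\<^bsub>G\<^esub> \<B> (dagger G H \<Phi> \<B> h)"

text \<open>The linear action \<open>h \<mapsto> \<Theta>(h)\<^sub>*\<close> on the Lie algebra of \<open>G\<close>; each \<open>\<Theta>(h)\<close> fixes the unit of \<open>G\<close>.\<close>

definition Theta_lin ::
  "('m, 'e::real_normed_vector) lie_struct \<Rightarrow> ('n, 'f) lie_struct \<Rightarrow> ('m \<Rightarrow> 'n \<Rightarrow> 'n) \<Rightarrow>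
   ('n \<Rightarrow> 'm) \<Rightarrow> 'n \<Rightarrow> 'e \<Rightarrow>\<^sub>L 'e" where
  "Theta_lin G H \<Phi> \<B> h =
     Blinfun (tangent_map (atlas G) (atlas G) (Theta G H \<Phi> \<B> h) \<one>\<^bsub>G\<^esub>)"

end

theory Submission
  imports Defs
begin

text \<open>
  Put \<open>k(h) = h\<^sup>\<dagger>\<close>. The definition of \<open>\<Theta>\<close> says
  \<open>\<B>(\<Phi>(g) k(h)) \<cdot> \<Theta>(h)g = g \<cdot> \<B>(k(h))\<close> for all \<open>g\<close>, \<open>h\<close>.
  Read this in charts around the units and differentiate it at \<open>(e, e)\<close>, in \<open>g\<close> along \<open>x\<close> and in \<open>h\<close>
  along \<open>u\<close>. Write \<open>m(v; w)\<close> for the mixed derivative of the multiplication of \<open>G\<close> along \<open>v\<close> in the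
  first and \<open>w\<close> in the second factor, so that \<open>[v, w] = m(v; w) - m(w; v)\<close>. The equation \<open>h \<star> k(h) = e\<close>
  shows that \<open>k\<close> has derivative \<open>-1\<close> at \<open>e\<close>, hence \<open>h \<mapsto> \<B>(k(h))\<close> has derivative \<open>-B\<close>, and
  \<open>(g, h) \<mapsto> \<Phi>(g) k(h)\<close> has mixed derivative \<open>-\<phi>(x)u\<close>. The first derivative of the latter map along \<open>x\<close>
  vanishes because \<open>\<Phi>(g)\<close> fixes the unit, so \<open>\<B>(\<Phi>(g) k(h))\<close> has mixed derivative \<open>-B(\<phi>(x)u)\<close>. As
  \<open>\<Theta>(h)\<close> fixes the unit and \<open>\<Theta>(e)\<close> is the identity, the equation becomes

    \<open>m(-B u; x) - B(\<phi>(x)u) + \<Theta>\<^sub>*(u)x = m(x; -B u)\<close>,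

  which is the assertion.

  Two points carry the argument: the mixed derivatives of the two sides have to be taken in the same
  order although \<open>\<Theta>\<^sub>*\<close> and \<open>\<phi>\<close> prescribe different ones, which is settled by
  \<open>second_derivative_symmetric\<close>; and a tangent map of a family of tangent maps has to be recognized as a
  mixed derivative, which is \<open>has_derivative_partial_derivative\<close>. The calculation above is
  \<open>mixed_derivative_of_local_identity\<close>.
\<close>

section \<open>Pointwise second derivatives\<close>

text \<open>
  The derivative is taken as a map into the normed space of operators, so that the chain rule for
  it is the product rule for operator composition. Differentiability of that map at the single
  point \<open>a\<close> suffices for the symmetry of second derivatives and depends only on the germ of \<open>f\<close>
  at \<open>a\<close>, which spares all bookkeeping about the open sets on which charts are defined.
\<close>

definition twice_differentiable :: "('a::real_normed_vector \<Rightarrow> 'b::real_normed_vector) \<Rightarrow> 'a \<Rightarrow> bool"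
  where "twice_differentiable f a \<longleftrightarrow>
    (\<exists>f'. (\<forall>\<^sub>F y in nhds a. (f has_derivative blinfun_apply (f' y)) (at y)) \<and> f' differentiable (at a))"

text \<open>
  The direction \<open>v\<close> is the inner one: first along \<open>v\<close>, then along \<open>u\<close>. This is the order in which
  the tangent maps \<open>\<Theta>(h)\<^sub>*\<close> and \<open>\<Phi>(g)\<^sub>*\<close> are formed before they are differentiated in \<open>h\<close> and \<open>g\<close>.
\<close>

definition second_derivative ::
    "('a::real_normed_vector \<Rightarrow> 'b::real_normed_vector) \<Rightarrow> 'a \<Rightarrow> 'a \<Rightarrow> 'a \<Rightarrow> 'b"
  where "second_derivative f a u v =
    frechet_derivative (\<lambda>y. frechet_derivative f (at y) v) (at a) u"

lemma has_derivative_eventually_cong: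
  assumes "\<forall>\<^sub>F y in nhds a. f y = g y"
  shows "(f has_derivative f') (at a) \<longleftrightarrow> (g has_derivative f') (at a)"
proof -
  have "\<forall>\<^sub>F y in at a. f y = g y" "f a = g a"
    using assms eventually_nhds_x_imp_x[OF assms] by (auto simp: eventually_at_filter elim: eventually_mono)
  then show ?thesis
    using has_derivative_transform_eventually[of f f' a UNIV g]
      has_derivative_transform_eventually[of g f' a UNIV f] by (auto simp: eq_commute)
qed

lemma frechet_derivative_eventually_cong:
  assumes "\<forall>\<^sub>F y in nhds a. f y = g y"
  shows "frechet_derivative f (at a) = frechet_derivative g (at a)"
  unfolding frechet_derivative_def using has_derivative_eventually_cong[OF assms] by simp

lemma twice_differentiableI:
  assumes "\<forall>\<^sub>F y in nhds a. (f has_derivative blinfun_apply (f' y)) (at y)"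
    and "(f' has_derivative f'') (at a)"
  shows "twice_differentiable f a"
    and "second_derivative f a u v = blinfun_apply (f'' u) v"
    and "frechet_derivative f (at a) = blinfun_apply (f' a)"
proof -
  show "twice_differentiable f a"
    using assms unfolding twice_differentiable_def differentiable_def by blast
  have "\<forall>\<^sub>F y in nhds a. frechet_derivative f (at y) v = blinfun_apply (f' y) v"
    using assms(1) by eventually_elim (metis frechet_derivative_at)
  then have "second_derivative f a u v = frechet_derivative (\<lambda>y. blinfun_apply (f' y) v) (at a) u"
    unfolding second_derivative_def by (metis frechet_derivative_eventually_cong)
  moreover have "((\<lambda>y. blinfun_apply (f' y) v) has_derivative (\<lambda>u. blinfun_apply (f'' u) v)) (at a)"
    by (intro bounded_linear.has_derivative[OF _ assms(2)] blinfun.bounded_linear_left)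
  ultimately show "second_derivative f a u v = blinfun_apply (f'' u) v"
    by (simp add: frechet_derivative_at[symmetric])
  show "frechet_derivative f (at a) = blinfun_apply (f' a)"
    using eventually_nhds_x_imp_x[OF assms(1)] by (simp add: frechet_derivative_at[symmetric])
qed

lemma twice_differentiableE:
  assumes "twice_differentiable f a"
  obtains f' f'' where "\<forall>\<^sub>F y in nhds a. (f has_derivative blinfun_apply (f' y)) (at y)"
    and "(f' has_derivative f'') (at a)"
    and "\<And>u v. second_derivative f a u v = blinfun_apply (f'' u) v"
    and "frechet_derivative f (at a) = blinfun_apply (f' a)"
proof -
  obtain f' f'' where d: "\<forall>\<^sub>F y in nhds a. (f has_derivative blinfun_apply (f' y)) (at y)"
    "(f' has_derivative f'') (at a)"
    using assms unfolding twice_differentiable_def differentiable_def by blast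
  show thesis by (rule that[OF d twice_differentiableI(2,3)[OF d]])
qed

lemma twice_differentiable_has_derivative:
  assumes "twice_differentiable f a"
  shows "(f has_derivative frechet_derivative f (at a)) (at a)"
proof -
  obtain f' where "\<forall>\<^sub>F y in nhds a. (f has_derivative blinfun_apply (f' y)) (at y)"
    "frechet_derivative f (at a) = blinfun_apply (f' a)"
    by (rule twice_differentiableE[OF assms]) (rule that)
  then show ?thesis using eventually_nhds_x_imp_x by fastforce
qed

lemma twice_differentiable_cong:
  assumes "\<forall>\<^sub>F y in nhds a. f y = g y"
  shows "twice_differentiable f a \<longleftrightarrow> twice_differentiable g a"
    and "second_derivative f a = second_derivative g a"
proof -
  have ev: "\<forall>\<^sub>F y in nhds a. \<forall>\<^sub>F z in nhds y. f z = g z"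
    using assms by (simp add: eventually_eventually)
  then have "\<forall>\<^sub>F y in nhds a. \<forall>f'. (f has_derivative f') (at y) = (g has_derivative f') (at y)"
    by eventually_elim (intro allI has_derivative_eventually_cong)
  then have "(\<forall>\<^sub>F y in nhds a. (f has_derivative blinfun_apply (f' y)) (at y)) \<longleftrightarrow>
      (\<forall>\<^sub>F y in nhds a. (g has_derivative blinfun_apply (f' y)) (at y))" for f'
    by (intro eventually_subst) (auto elim: eventually_mono)
  then show "twice_differentiable f a \<longleftrightarrow> twice_differentiable g a"
    unfolding twice_differentiable_def by simp
  have "\<forall>\<^sub>F y in nhds a. frechet_derivative f (at y) v = frechet_derivative g (at y) v" for v
    using ev by eventually_elim (metis frechet_derivative_eventually_cong)
  then show "second_derivative f a = second_derivative g a"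
    unfolding second_derivative_def by (intro ext) (metis frechet_derivative_eventually_cong)
qed

lemma second_derivative_linear_right:
  assumes "twice_differentiable f a"
  shows "bounded_linear (second_derivative f a u)"
proof -
  obtain f'' where f'': "\<And>u v. second_derivative f a u v = blinfun_apply (f'' u) v"
    by (rule twice_differentiableE[OF assms]) (rule that)
  show ?thesis unfolding f'' by (rule blinfun.bounded_linear_right)
qed

lemma second_derivative_zero_right:
  "twice_differentiable f a \<Longrightarrow> second_derivative f a u 0 = 0"
  using second_derivative_linear_right linear_simps(3) by blast

lemma twice_differentiable_compose:
  assumes f: "twice_differentiable f a" and g: "twice_differentiable g (f a)"
  shows "twice_differentiable (\<lambda>x. g (f x)) a"
    and "second_derivative (\<lambda>x. g (f x)) a u v =
      second_derivative g (f a) (frechet_derivative f (at a) u) (frechet_derivative f (at a) v) +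
      frechet_derivative g (at (f a)) (second_derivative f a u v)"
    and "frechet_derivative (\<lambda>x. g (f x)) (at a) u =
      frechet_derivative g (at (f a)) (frechet_derivative f (at a) u)"
proof -
  obtain f' f'' where f': "\<forall>\<^sub>F y in nhds a. (f has_derivative blinfun_apply (f' y)) (at y)"
    "(f' has_derivative f'') (at a)"
    "\<And>u v. second_derivative f a u v = blinfun_apply (f'' u) v"
    "frechet_derivative f (at a) = blinfun_apply (f' a)"
    by (rule twice_differentiableE[OF f]) (rule that)
  obtain g' g'' where g': "\<forall>\<^sub>F y in nhds (f a). (g has_derivative blinfun_apply (g' y)) (at y)"
    "(g' has_derivative g'') (at (f a))"
    "\<And>u v. second_derivative g (f a) u v = blinfun_apply (g'' u) v"
    "frechet_derivative g (at (f a)) = blinfun_apply (g' (f a))"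
    by (rule twice_differentiableE[OF g]) (rule that)
  have df: "(f has_derivative f' a) (at a)" using eventually_nhds_x_imp_x[OF f'(1)] .
  have "filterlim f (nhds (f a)) (nhds a)"
    using has_derivative_continuous[OF df] by (simp add: isCont_def tendsto_at_iff_tendsto_nhds)
  from eventually_compose_filterlim[OF g'(1) this] have "\<forall>\<^sub>F y in nhds a. (g has_derivative blinfun_apply (g' (f y))) (at (f y))"
    .
  then have ev: "\<forall>\<^sub>F y in nhds a.
      ((\<lambda>x. g (f x)) has_derivative blinfun_apply (g' (f y) o\<^sub>L f' y)) (at y)"
    using f'(1)
  proof eventually_elim
    case (elim y)
    then show ?case using has_derivative_compose[of f "f' y" y UNIV g "g' (f y)"]
      by (simp add: blinfun_compose.rep_eq o_def)
  qed
  have "((\<lambda>y. g' (f y)) has_derivative (\<lambda>u. g'' (f' a u))) (at a)"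
    using has_derivative_compose[OF df g'(2)] .
  then have d: "((\<lambda>y. g' (f y) o\<^sub>L f' y) has_derivative
      (\<lambda>u. (g' (f a) o\<^sub>L f'' u) + (g'' (f' a u) o\<^sub>L f' a))) (at a)"
    by (intro bounded_bilinear.FDERIV[OF bounded_bilinear_blinfun_compose] f'(2))
  note c = twice_differentiableI[OF ev d]
  show "twice_differentiable (\<lambda>x. g (f x)) a" by (rule c(1))
  show "second_derivative (\<lambda>x. g (f x)) a u v =
      second_derivative g (f a) (frechet_derivative f (at a) u) (frechet_derivative f (at a) v) +
      frechet_derivative g (at (f a)) (second_derivative f a u v)"
    unfolding c(2) f'(3,4) g'(3,4) by (simp add: blinfun.add_left)
  show "frechet_derivative (\<lambda>x. g (f x)) (at a) u =
      frechet_derivative g (at (f a)) (frechet_derivative f (at a) u)"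
    unfolding c(3) f'(4) g'(4) by simp
qed

lemma twice_differentiable_linear:
  assumes "bounded_linear f"
  shows "twice_differentiable f a" and "second_derivative f a u v = 0"
    and "frechet_derivative f (at a) = f"
proof -
  have "\<forall>\<^sub>F y in nhds a. (f has_derivative blinfun_apply (Blinfun f)) (at y)"
    using assms by (simp add: bounded_linear_Blinfun_apply bounded_linear_imp_has_derivative)
  note c = twice_differentiableI[OF this has_derivative_const]
  show "twice_differentiable f a" "second_derivative f a u v = 0" "frechet_derivative f (at a) = f"
    using c assms by (simp_all add: bounded_linear_Blinfun_apply)
qed

lemma twice_differentiable_Pair:
  assumes f: "twice_differentiable f a" and g: "twice_differentiable g a"
  shows "twice_differentiable (\<lambda>x. (f x, g x)) a"
    and "second_derivative (\<lambda>x. (f x, g x)) a u v = (second_derivative f a u v, second_derivative g a u v)"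
    and "frechet_derivative (\<lambda>x. (f x, g x)) (at a) u =
      (frechet_derivative f (at a) u, frechet_derivative g (at a) u)"
proof -
  obtain f' f'' where f': "\<forall>\<^sub>F y in nhds a. (f has_derivative blinfun_apply (f' y)) (at y)"
    "(f' has_derivative f'') (at a)"
    "\<And>u v. second_derivative f a u v = blinfun_apply (f'' u) v"
    "frechet_derivative f (at a) = blinfun_apply (f' a)"
    by (rule twice_differentiableE[OF f]) (rule that)
  obtain g' g'' where g': "\<forall>\<^sub>F y in nhds a. (g has_derivative blinfun_apply (g' y)) (at y)"
    "(g' has_derivative g'') (at a)"
    "\<And>u v. second_derivative g a u v = blinfun_apply (g'' u) v"
    "frechet_derivative g (at a) = blinfun_apply (g' a)"
    by (rule twice_differentiableE[OF g]) (rule that)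
  define I where "I = Blinfun (\<lambda>x::'b. (x, 0::'c))"
  define J where "J = Blinfun (\<lambda>x::'c. (0::'b, x))"
  have I: "blinfun_apply I x = (x, 0)" for x
    unfolding I_def by (subst bounded_linear_Blinfun_apply) (auto intro!: bounded_linear_intros)
  have J: "blinfun_apply J x = (0, x)" for x
    unfolding J_def by (subst bounded_linear_Blinfun_apply) (auto intro!: bounded_linear_intros)
  have ev: "\<forall>\<^sub>F y in nhds a.
      ((\<lambda>x. (f x, g x)) has_derivative blinfun_apply ((I o\<^sub>L f' y) + (J o\<^sub>L g' y))) (at y)"
    using f'(1) g'(1)
  proof eventually_elim
    case (elim y)
    have *: "blinfun_apply ((I o\<^sub>L f' y) + (J o\<^sub>L g' y)) = (\<lambda>h. (f' y h, g' y h))"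
      by (auto simp: blinfun.add_left I J)
    show ?case unfolding * by (intro has_derivative_Pair elim)
  qed
  have d: "((\<lambda>y. (I o\<^sub>L f' y) + (J o\<^sub>L g' y)) has_derivative
      (\<lambda>u. (I o\<^sub>L f'' u) + (J o\<^sub>L g'' u))) (at a)"
    by (intro has_derivative_add f'(2) g'(2)
        bounded_linear.has_derivative[OF bounded_bilinear.bounded_linear_right[OF bounded_bilinear_blinfun_compose]])
  note c = twice_differentiableI[OF ev d]
  show "twice_differentiable (\<lambda>x. (f x, g x)) a" by (rule c(1))
  show "second_derivative (\<lambda>x. (f x, g x)) a u v = (second_derivative f a u v, second_derivative g a u v)"
    unfolding c(2) f'(3) g'(3) by (simp add: blinfun.add_left I J)
  show "frechet_derivative (\<lambda>x. (f x, g x)) (at a) u =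
      (frechet_derivative f (at a) u, frechet_derivative g (at a) u)"
    unfolding c(3) f'(4) g'(4) by (simp add: blinfun.add_left I J)
qed

text \<open>
  The second difference of \<open>f\<close> over the parallelogram spanned by \<open>t u\<close> and \<open>t v\<close> is the increment over
  \<open>{0..1}\<close> of \<open>s \<mapsto> f (a + t u + s t v) - f (a + s t v)\<close>. The derivative of this function of \<open>s\<close> differs
  from \<open>t\<^sup>2 f''(u) v\<close> by \<open>o(t\<^sup>2)\<close> because \<open>f'\<close> is differentiable at \<open>a\<close>, and the mean value inequality
  carries the estimate over to the increment.
\<close>

lemma second_difference_estimate:
  fixes f :: "'a::real_normed_vector \<Rightarrow> 'b::real_normed_vector"
  assumes ev: "\<forall>\<^sub>F y in nhds a. (f has_derivative blinfun_apply (f' y)) (at y)"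
    and d: "(f' has_derivative f'') (at a)" and "0 < e"
  shows "\<forall>\<^sub>F t in at_right (0::real).
    norm (f (a + t *\<^sub>R u + t *\<^sub>R v) - f (a + t *\<^sub>R u) - f (a + t *\<^sub>R v) + f a - t\<^sup>2 *\<^sub>R blinfun_apply (f'' u) v)
      \<le> e * t\<^sup>2"
proof -
  \<comment> \<open>\<open>t C\<close> bounds the sum of the distances from \<open>a\<close> of the two points moving with \<open>s\<close>; \<open>e'\<close> below is chosen so that \<open>e' M \<le> e\<close>.\<close>
  define C where "C = norm u + 2 * norm v"
  define M where "M = C * norm v"
  have C: "C \<ge> 0" "M \<ge> 0" by (auto simp: C_def M_def)
  define e' where "e' = e / (M + 1)"
  have e': "e' > 0" using C \<open>0 < e\<close> by (simp add: e'_def)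
  obtain r1 where r1: "r1 > 0" "\<And>y. dist y a < r1 \<Longrightarrow> (f has_derivative blinfun_apply (f' y)) (at y)"
    using ev unfolding eventually_nhds_metric by blast
  obtain r2 where r2: "r2 > 0" "\<And>y. norm (y - a) < r2 \<Longrightarrow>
      norm (f' y - f' a - f'' (y - a)) \<le> e' * norm (y - a)"
    using d e' unfolding has_derivative_at_alt by blast
  define r where "r = min r1 r2 / (C + 1)"
  have r: "r > 0" using r1 r2 C by (simp add: r_def)
  interpret f'': bounded_linear f'' using d by (rule has_derivative_bounded_linear)
  have main: "norm (f (a + t *\<^sub>R u + t *\<^sub>R v) - f (a + t *\<^sub>R u) - f (a + t *\<^sub>R v) + f a - t\<^sup>2 *\<^sub>R blinfun_apply (f'' u) v)
      \<le> e * t\<^sup>2" if t: "0 < t" "t < r" for t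
  proof -
    have tC: "t * C < min r1 r2"
    proof -
      have "t * C \<le> t * (C + 1)" using t by simp
      also have "\<dots> < r * (C + 1)" using t C by simp
      finally show ?thesis using C by (simp add: r_def)
    qed
    have small1: "norm (t *\<^sub>R u + (s * t) *\<^sub>R v) \<le> t * (norm u + norm v)"
      and small2: "norm ((s * t) *\<^sub>R v) \<le> t * norm v" if "s \<in> {0..1}" for s
    proof -
      have st: "\<bar>s * t\<bar> \<le> t" using that t by (simp add: abs_mult mult_left_le_one_le)
      show 2: "norm ((s * t) *\<^sub>R v) \<le> t * norm v" using st by (simp add: mult_right_mono)
      show "norm (t *\<^sub>R u + (s * t) *\<^sub>R v) \<le> t * (norm u + norm v)"
        using norm_triangle_ineq[of "t *\<^sub>R u" "(s * t) *\<^sub>R v"] 2 t by (simp add: distrib_left)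
    qed
    have le: "t * (norm u + norm v) \<le> t * C" "t * norm v \<le> t * C"
      using t by (auto simp: C_def intro!: mult_left_mono)
    let ?p = "\<lambda>s. a + t *\<^sub>R u + (s * t) *\<^sub>R v" and ?q = "\<lambda>s. a + (s * t) *\<^sub>R v"
    have near: "norm (?p s - a) < min r1 r2" "norm (?q s - a) < min r1 r2" if "s \<in> {0..1}" for s
      using small1[OF that] small2[OF that] le tC by (auto simp: algebra_simps)
    let ?h = "\<lambda>s. f (?p s) - f (?q s) - s *\<^sub>R (t\<^sup>2 *\<^sub>R blinfun_apply (f'' u) v)"
    let ?h' = "\<lambda>s k. f' (?p s) ((k * t) *\<^sub>R v) - f' (?q s) ((k * t) *\<^sub>R v) -
        k *\<^sub>R (t\<^sup>2 *\<^sub>R blinfun_apply (f'' u) v)"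
    have hd: "(?h has_derivative ?h' s) (at s within {0..1})" if "s \<in> {0..1}" for s
    proof -
      have p: "(?p has_derivative (\<lambda>k. (k * t) *\<^sub>R v)) (at s within {0..1})"
        and q: "(?q has_derivative (\<lambda>k. (k * t) *\<^sub>R v)) (at s within {0..1})"
        by (auto intro!: derivative_eq_intros)
      have fp: "(f has_derivative f' (?p s)) (at (?p s))" and fq: "(f has_derivative f' (?q s)) (at (?q s))"
        using near[OF that] r1(2) by (auto simp: dist_norm)
      show ?thesis
        by (intro has_derivative_diff has_derivative_compose[OF p fp] has_derivative_compose[OF q fq]
            has_derivative_scaleR_left has_derivative_ident)
    qed
    have bd: "onorm (?h' s) \<le> e * t\<^sup>2" if "s \<in> {0..1}" for s
    proof (rule onorm_le)
      fix k :: real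
      have R1: "norm (f' (?p s) - f' a - f'' (?p s - a)) \<le> e' * norm (?p s - a)"
        and R2: "norm (f' (?q s) - f' a - f'' (?q s - a)) \<le> e' * norm (?q s - a)"
        using near[OF that] by (auto simp only: min_less_iff_conj intro!: r2(2))
      have lin: "f'' (?p s - a) - f'' (?q s - a) = t *\<^sub>R f'' u"
        by (simp flip: f''.diff f''.scaleR)
      define R where "R = f' (?p s) - f' (?q s) - t *\<^sub>R f'' u"
      have "R = (f' (?p s) - f' a - f'' (?p s - a)) - (f' (?q s) - f' a - f'' (?q s - a))"
        unfolding R_def lin[symmetric] by simp
      then have "norm R \<le> e' * norm (?p s - a) + e' * norm (?q s - a)"
        by (simp only:) (rule order_trans[OF norm_triangle_ineq4 add_mono[OF R1 R2]])
      also have "\<dots> \<le> e' * (t * (norm u + norm v)) + e' * (t * norm v)"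
        using small1[OF that] small2[OF that] e' by (intro add_mono mult_left_mono) (auto simp: algebra_simps)
      finally have R: "norm R \<le> e' * t * C" by (simp add: C_def algebra_simps)
      have "?h' s k = (k * t) *\<^sub>R blinfun_apply R v"
        by (simp add: R_def blinfun.bilinear_simps power2_eq_square algebra_simps)
      then have "norm (?h' s k) \<le> \<bar>k * t\<bar> * (norm R * norm v)"
        by (simp add: mult_left_mono norm_blinfun)
      also have "\<dots> \<le> \<bar>k * t\<bar> * ((e' * t * C) * norm v)"
        using R by (intro mult_left_mono mult_right_mono) auto
      also have "\<dots> = (e' * M) * t\<^sup>2 * norm k"
        using t by (simp add: M_def abs_mult power2_eq_square)
      also have "\<dots> \<le> e * t\<^sup>2 * norm k"
      proof -
        have "e' * M \<le> e" using C \<open>0 < e\<close> by (simp add: e'_def field_simps)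
        then show ?thesis by (intro mult_right_mono) auto
      qed
      finally show "norm (?h' s k) \<le> e * t\<^sup>2 * norm k" .
    qed
    have "norm (?h 1 - ?h 0) \<le> e * t\<^sup>2 * norm (1 - 0 :: real)"
      by (rule differentiable_bound[of "{0..1::real}" ?h ?h']) (use hd bd in auto)
    then show ?thesis by (simp add: algebra_simps)
  qed
  show ?thesis unfolding eventually_at_right_field using r main by blast
qed

text \<open>
  The second difference is symmetric in \<open>u\<close> and \<open>v\<close>, and both mixed derivatives are its limit after
  division by \<open>t\<^sup>2\<close>.
\<close>

lemma second_derivative_symmetric:
  assumes "twice_differentiable f a"
  shows "second_derivative f a u v = second_derivative f a v u"
proof -
  obtain f' f'' where f': "\<forall>\<^sub>F y in nhds a. (f has_derivative blinfun_apply (f' y)) (at y)"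
    "(f' has_derivative f'') (at a)"
    "\<And>u v. second_derivative f a u v = blinfun_apply (f'' u) v"
    by (rule twice_differentiableE[OF assms]) (rule that)
  have "norm (blinfun_apply (f'' u) v - blinfun_apply (f'' v) u) \<le> 0"
  proof (rule field_le_epsilon)
    fix e :: real assume "0 < e"
    then have e2: "0 < e / 2" by simp
    let ?S = "\<lambda>t. f (a + t *\<^sub>R u + t *\<^sub>R v) - f (a + t *\<^sub>R u) - f (a + t *\<^sub>R v) + f a"
    have "\<forall>\<^sub>F t::real in at_right 0. t > 0 \<and> norm (?S t - t\<^sup>2 *\<^sub>R blinfun_apply (f'' u) v) \<le> e/2 * t\<^sup>2 \<and>
        norm (?S t - t\<^sup>2 *\<^sub>R blinfun_apply (f'' v) u) \<le> e/2 * t\<^sup>2"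
      using second_difference_estimate[OF f'(1,2) e2, of u v]
        second_difference_estimate[OF f'(1,2) e2, of v u] eventually_at_right_less[of 0]
      by eventually_elim (simp add: algebra_simps)
    then obtain t :: real where t: "t > 0" "norm (?S t - t\<^sup>2 *\<^sub>R blinfun_apply (f'' u) v) \<le> e/2 * t\<^sup>2"
        "norm (?S t - t\<^sup>2 *\<^sub>R blinfun_apply (f'' v) u) \<le> e/2 * t\<^sup>2"
      using eventually_happens trivial_limit_at_right_real by blast
    have "t\<^sup>2 * norm (blinfun_apply (f'' u) v - blinfun_apply (f'' v) u) =
        norm ((?S t - t\<^sup>2 *\<^sub>R blinfun_apply (f'' v) u) - (?S t - t\<^sup>2 *\<^sub>R blinfun_apply (f'' u) v))"
      by (simp flip: scaleR_diff_right)
    also have "\<dots> \<le> e/2 * t\<^sup>2 + e/2 * t\<^sup>2"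
      by (rule order_trans[OF norm_triangle_ineq4 add_mono[OF t(3,2)]])
    finally have "t\<^sup>2 * norm (blinfun_apply (f'' u) v - blinfun_apply (f'' v) u) \<le> t\<^sup>2 * e" by (simp add: algebra_simps)
    then show "norm (blinfun_apply (f'' u) v - blinfun_apply (f'' v) u) \<le> 0 + e" using t(1) by simp
  qed
  then show ?thesis by (simp add: f'(3))
qed

text \<open>
  A family of partial differentials, as an operator-valued function of the parameter, is
  differentiated by the mixed second derivative. The tangent maps in the definitions of \<open>\<phi>\<close> and of
  the differential of \<open>\<Theta>\<close> have this form in coordinates.
\<close>

lemma has_derivative_partial_derivative:
  fixes f :: "'a::real_normed_vector \<times> 'b::real_normed_vector \<Rightarrow> 'c::real_normed_vector"
  assumes "twice_differentiable f (a, b)"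
  shows "((\<lambda>x. Blinfun (frechet_derivative (\<lambda>y. f (x, y)) (at b))) has_derivative
      (\<lambda>u. Blinfun (\<lambda>v. second_derivative f (a, b) (u, 0) (0, v)))) (at a)"
    and "\<forall>\<^sub>F x in nhds a. (\<lambda>y. f (x, y)) differentiable (at b)"
    and "bounded_linear (\<lambda>v. second_derivative f (a, b) (u, 0) (0, v))"
proof -
  obtain f' f'' where f': "\<forall>\<^sub>F y in nhds (a, b). (f has_derivative blinfun_apply (f' y)) (at y)"
    "(f' has_derivative f'') (at (a, b))"
    "\<And>u v. second_derivative f (a, b) u v = blinfun_apply (f'' u) v"
    by (rule twice_differentiableE[OF assms]) (rule that)
  define J where "J = Blinfun (\<lambda>x::'b. (0::'a, x))"
  have J: "blinfun_apply J x = (0, x)" for x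
    unfolding J_def by (subst bounded_linear_Blinfun_apply) (auto intro!: bounded_linear_intros)
  have "filterlim (\<lambda>x. (x, b)) (nhds (a, b)) (nhds a)"
    by (intro tendsto_intros filterlim_ident)
  from eventually_compose_filterlim[OF f'(1) this]
  have "\<forall>\<^sub>F x in nhds a. (f has_derivative blinfun_apply (f' (x, b))) (at (x, b))" .
  then have ev: "\<forall>\<^sub>F x in nhds a. ((\<lambda>y. f (x, y)) has_derivative blinfun_apply (f' (x, b) o\<^sub>L J)) (at b)"
  proof eventually_elim
    case (elim x)
    have "((\<lambda>y. (x, y)) has_derivative (\<lambda>h. (0, h))) (at b)"
      by (intro has_derivative_Pair has_derivative_const has_derivative_ident)
    from has_derivative_compose[OF this elim] show ?case
      by (simp add: blinfun_compose.rep_eq o_def J)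
  qed
  then show "\<forall>\<^sub>F x in nhds a. (\<lambda>y. f (x, y)) differentiable (at b)"
    by eventually_elim (auto simp: differentiable_def)
  from ev have eq: "\<forall>\<^sub>F x in nhds a. Blinfun (frechet_derivative (\<lambda>y. f (x, y)) (at b)) = f' (x, b) o\<^sub>L J"
    by eventually_elim (metis blinfun_apply_inverse frechet_derivative_at)
  have "((\<lambda>x. (x, b)) has_derivative (\<lambda>h. (h, 0))) (at a)"
    by (intro has_derivative_Pair has_derivative_const has_derivative_ident)
  from has_derivative_compose[OF this f'(2)]
  have D: "((\<lambda>x. f' (x, b) o\<^sub>L J) has_derivative (\<lambda>u. f'' (u, 0) o\<^sub>L J)) (at a)"
    by (rule bounded_linear.has_derivative[OF bounded_bilinear.bounded_linear_left[OF bounded_bilinear_blinfun_compose]])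
  have s: "(\<lambda>v. second_derivative f (a, b) (u, 0) (0, v)) = blinfun_apply (f'' (u, 0) o\<^sub>L J)" for u
    by (auto simp: f'(3) J)
  show "((\<lambda>x. Blinfun (frechet_derivative (\<lambda>y. f (x, y)) (at b))) has_derivative
      (\<lambda>u. Blinfun (\<lambda>v. second_derivative f (a, b) (u, 0) (0, v)))) (at a)"
    unfolding s blinfun_apply_inverse has_derivative_eventually_cong[OF eq] by (rule D)
  show "bounded_linear (\<lambda>v. second_derivative f (a, b) (u, 0) (0, v))"
    unfolding s by (rule blinfun.bounded_linear_right)
qed

lemma frechet_derivative_prod:
  fixes f :: "'a::real_normed_vector \<times> 'b::real_normed_vector \<Rightarrow> 'c::real_normed_vector"
  assumes "twice_differentiable f (a, b)"
  shows "frechet_derivative f (at (a, b)) (u, v) =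
    frechet_derivative (\<lambda>x. f (x, b)) (at a) u + frechet_derivative (\<lambda>y. f (a, y)) (at b) v"
proof -
  have d: "(f has_derivative frechet_derivative f (at (a, b))) (at (a, b))"
    by (rule twice_differentiable_has_derivative[OF assms])
  have "((\<lambda>x. (x, b)) has_derivative (\<lambda>h. (h, 0))) (at a)"
    by (intro has_derivative_Pair has_derivative_const has_derivative_ident)
  from has_derivative_compose[OF this d]
  have 1: "frechet_derivative (\<lambda>x. f (x, b)) (at a) u = frechet_derivative f (at (a, b)) (u, 0)"
    by (metis frechet_derivative_at)
  have "((\<lambda>y. (a, y)) has_derivative (\<lambda>h. (0, h))) (at b)"
    by (intro has_derivative_Pair has_derivative_const has_derivative_ident)
  from has_derivative_compose[OF this d]
  have 2: "frechet_derivative (\<lambda>y. f (a, y)) (at b) v = frechet_derivative f (at (a, b)) (0, v)"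
    by (metis frechet_derivative_at)
  interpret bounded_linear "frechet_derivative f (at (a, b))"
    using d by (rule has_derivative_bounded_linear)
  show ?thesis unfolding 1 2 by (simp flip: add)
qed

text \<open>
  The same for one fixed vector \<open>v\<close>; left-invariant vector fields are partial derivatives of this kind.
\<close>

lemma has_derivative_partial_derivative_apply:
  fixes f :: "'a::real_normed_vector \<times> 'b::real_normed_vector \<Rightarrow> 'c::real_normed_vector"
  assumes "twice_differentiable f (a, b)"
  shows "((\<lambda>x. frechet_derivative (\<lambda>y. f (x, y)) (at b) v) has_derivative
      (\<lambda>u. second_derivative f (a, b) (u, 0) (0, v))) (at a)"
proof -
  note p = has_derivative_partial_derivative[OF assms]
  have ev: "\<forall>\<^sub>F x in nhds a. frechet_derivative (\<lambda>y. f (x, y)) (at b) v =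
      blinfun_apply (Blinfun (frechet_derivative (\<lambda>y. f (x, y)) (at b))) v"
    using p(2) by eventually_elim
      (metis bounded_linear_Blinfun_apply frechet_derivative_works has_derivative_bounded_linear)
  have eq: "blinfun_apply (Blinfun (\<lambda>v. second_derivative f (a, b) (u, 0) (0, v))) v =
      second_derivative f (a, b) (u, 0) (0, v)" for u
    using p(3) by (simp add: bounded_linear_Blinfun_apply)
  from bounded_linear.has_derivative[OF blinfun.bounded_linear_left p(1), of v]
  show ?thesis unfolding eq has_derivative_eventually_cong[OF ev] .
qed

section \<open>Smooth maps are twice differentiable\<close>

text \<open>
  The group multiplications and the action are smooth maps on product manifolds, whose model space
  is a product.
\<close>

instance prod :: (finite_dim_inner, finite_dim_inner) finite_dim_inner
proof
  obtain A :: "'a set" where A: "finite A" "\<forall>u\<in>A. \<forall>v\<in>A. inner u v = (if u = v then 1 else 0)"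
      "\<forall>x. (\<forall>u\<in>A. inner x u = 0) \<longleftrightarrow> x = 0"
    using finite_orthonormal_basis by metis
  obtain B :: "'b set" where B: "finite B" "\<forall>u\<in>B. \<forall>v\<in>B. inner u v = (if u = v then 1 else 0)"
      "\<forall>x. (\<forall>u\<in>B. inner x u = 0) \<longleftrightarrow> x = 0"
    using finite_orthonormal_basis by metis
  have AA: "inner u u' = (if u = u' then 1 else 0)" if "u \<in> A" "u' \<in> A" for u u'
    using A(2) that by blast
  have BB: "inner v v' = (if v = v' then 1 else 0)" if "v \<in> B" "v' \<in> B" for v v'
    using B(2) that by blast
  have notin: "0 \<notin> A" "0 \<notin> B" using AA[of 0 0] BB[of 0 0] by auto
  let ?C = "(\<lambda>u. (u, 0)) ` A \<union> (\<lambda>v. (0, v)) ` B"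
  have orth: "inner p q = (if p = q then 1 else 0)" if "p \<in> ?C" "q \<in> ?C" for p q
    using that
  proof (elim UnE imageE)
    fix u u' assume "p = (u, 0)" "u \<in> A" "q = (u', 0)" "u' \<in> A"
    then show ?thesis by (simp add: AA)
  next
    fix u v assume "p = (u, 0)" "u \<in> A" "q = (0, v)" "v \<in> B"
    moreover have "v \<noteq> 0" using \<open>v \<in> B\<close> notin(2) by metis
    ultimately show ?thesis by simp
  next
    fix u v assume "p = (0, v)" "v \<in> B" "q = (u, 0)" "u \<in> A"
    moreover have "v \<noteq> 0" using \<open>v \<in> B\<close> notin(2) by metis
    ultimately show ?thesis by simp
  next
    fix v v' assume "p = (0, v)" "v \<in> B" "q = (0, v')" "v' \<in> B"
    then show ?thesis by (simp add: BB)
  qed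
  have span: "(\<forall>u\<in>?C. inner p u = 0) \<longleftrightarrow> p = 0" for p
  proof -
    have "(\<forall>u\<in>?C. inner p u = 0) \<longleftrightarrow> (\<forall>u\<in>A. inner (fst p) u = 0) \<and> (\<forall>v\<in>B. inner (snd p) v = 0)"
      by (simp add: ball_Un inner_prod_def)
    also have "\<dots> \<longleftrightarrow> fst p = 0 \<and> snd p = 0" 
      by (simp only: A(3)[THEN spec] B(3)[THEN spec])
    finally show ?thesis by (simp add: prod_eq_iff)
  qed
  have "finite ?C" using A(1) B(1) by simp
  with orth span show "\<exists>B::('a \<times> 'b) set. finite B \<and>
      (\<forall>u\<in>B. \<forall>v\<in>B. inner u v = (if u = v then 1 else 0)) \<and>
      (\<forall>x. (\<forall>u\<in>B. inner x u = 0) \<longleftrightarrow> x = 0)" by (intro exI[of _ ?C] conjI ballI allI)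
qed

lemma finite_dim_expansion:
  obtains B :: "'a::finite_dim_inner set"
  where "finite B" "\<And>x::'a. x = (\<Sum>b\<in>B. inner x b *\<^sub>R b)"
proof -
  obtain B :: "'a set" where B: "finite B" "\<forall>u\<in>B. \<forall>v\<in>B. inner u v = (if u = v then 1 else 0)"
      "\<forall>x. (\<forall>u\<in>B. inner x u = 0) \<longleftrightarrow> x = 0"
    using finite_orthonormal_basis by metis
  have eq: "x = (\<Sum>b\<in>B. inner x b *\<^sub>R b)" for x :: 'a
  proof -
    let ?y = "\<Sum>b\<in>B. inner x b *\<^sub>R b"
    have "inner (x - ?y) u = 0" if "u \<in> B" for u
    proof -
      have "inner ?y u = (\<Sum>b\<in>B. inner x b * inner b u)"
        by (simp add: inner_sum_left)
      also have "\<dots> = (\<Sum>b\<in>B. if b = u then inner x b else 0)"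
        by (rule sum.cong[OF refl]) (simp add: B(2) that)
      also have "\<dots> = inner x u" using B(1) that by (simp add: sum.delta)
      finally show ?thesis by (simp add: inner_diff_left)
    qed
    then have "x - ?y = 0" using B(3) by blast
    then show ?thesis by (rule eq_iff_diff_eq_0[THEN iffD2])
  qed
  show thesis by (rule that[OF B(1) eq])
qed
text \<open>
  The notion \<open>Ck_on\<close> controls one directional derivative at a time. Finite dimension turns this into
  differentiability of the operator-valued derivative, which is a finite sum
  \<open>\<Sum>b. \<partial>\<^sub>b f(x) \<otimes> \<langle>b, -\<rangle>\<close> over an orthonormal basis.
\<close>

lemma twice_differentiable_of_smooth_on:
  fixes f :: "'a::finite_dim_inner \<Rightarrow> 'b::real_normed_vector"
  assumes "smooth_on S f" "open S" "a \<in> S"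
  shows "twice_differentiable f a"
proof -
  have "Ck_on (Suc (Suc 0)) S f" using assms(1) by (simp only: smooth_on_def)
  then have d1: "\<And>x. x \<in> S \<Longrightarrow> f differentiable (at x)"
    and d2: "\<And>x v. x \<in> S \<Longrightarrow> (\<lambda>x. frechet_derivative f (at x) v) differentiable (at x)"
    by auto
  obtain B :: "'a set" where B: "finite B" "\<And>x::'a. x = (\<Sum>b\<in>B. inner x b *\<^sub>R b)"
    by (rule finite_dim_expansion) (rule that)
  define f' where "f' x = (\<Sum>b\<in>B. blinfun_scaleR_left (frechet_derivative f (at x) b) o\<^sub>L blinfun_inner_left b)" for x
  have f': "(f has_derivative blinfun_apply (f' x)) (at x)" if "x \<in> S" for x
  proof -
    have d: "(f has_derivative frechet_derivative f (at x)) (at x)"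
      using d1[OF that] by (simp add: frechet_derivative_works)
    then interpret L: bounded_linear "frechet_derivative f (at x)" by (rule has_derivative_bounded_linear)
    have "frechet_derivative f (at x) h = f' x h" for h
      by (subst B(2)[of h]) (simp add: f'_def blinfun.sum_left L.sum L.scaleR blinfun_inner_left.rep_eq)
    with d show ?thesis by (metis ext)
  qed
  have "\<forall>\<^sub>F y in nhds a. y \<in> S" using assms(2,3) by (simp add: eventually_nhds_in_open)
  then have "\<forall>\<^sub>F y in nhds a. (f has_derivative blinfun_apply (f' y)) (at y)"
    by eventually_elim (rule f')
  moreover have "f' differentiable (at a)"
  proof -
    have "(\<lambda>x. blinfun_scaleR_left (frechet_derivative f (at x) b) o\<^sub>L blinfun_inner_left b) differentiable (at a)" for b
    proof -
      obtain D where "((\<lambda>x. frechet_derivative f (at x) b) has_derivative D) (at a)"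
        using d2[OF assms(3)] unfolding differentiable_def by blast
      from bounded_linear.has_derivative[OF bounded_linear_compose[OF
          bounded_bilinear.bounded_linear_left[OF bounded_bilinear_blinfun_compose]
          bounded_linear_blinfun_scaleR_left] this]
      show ?thesis unfolding differentiable_def by blast
    qed
    then show ?thesis unfolding f'_def using B(1) by (intro differentiable_sum) auto
  qed
  ultimately show ?thesis unfolding twice_differentiable_def by blast
qed

section \<open>The formula in coordinates\<close>

text \<open>
  The coordinate form of the proof. The maps \<open>m\<close>, \<open>mH\<close> and \<open>P\<close> stand for the multiplications of \<open>G\<close>
  and \<open>H\<close> and for the action, \<open>k\<close> for \<open>h \<mapsto> h\<^sup>\<dagger>\<close>, and \<open>T (q, p)\<close> for \<open>\<Theta>(h)g\<close>. The unit laws say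
  that near the base point \<open>m\<close>, \<open>mH\<close> have first derivative \<open>(v, w) \<mapsto> v + w\<close> and \<open>P\<close>, \<open>T\<close> have first
  derivative \<open>(v, w) \<mapsto> w\<close>. Hence in the mixed second derivative of either side of the identity \<open>id\<close>
  the chain rule leaves only the mixed second derivative of \<open>m\<close> and those of its arguments.
\<close>

lemma mixed_derivative_of_local_identity:
  fixes m :: "'e::real_normed_vector \<times> 'e \<Rightarrow> 'e" and mH :: "'f::real_normed_vector \<times> 'f \<Rightarrow> 'f"
    and P :: "'e \<times> 'f \<Rightarrow> 'f" and B :: "'f \<Rightarrow> 'e" and k :: "'f \<Rightarrow> 'f" and T :: "'f \<times> 'e \<Rightarrow> 'e"
  assumes tm: "twice_differentiable m (p0, p0)" and tmH: "twice_differentiable mH (q0, q0)"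
    and tP: "twice_differentiable P (p0, q0)" and tB: "twice_differentiable B q0"
    and tk: "twice_differentiable k q0" and tT: "twice_differentiable T (q0, p0)"
    and m1: "\<forall>\<^sub>F p in nhds p0. m (p, p0) = p" and m2: "\<forall>\<^sub>F p in nhds p0. m (p0, p) = p"
    and mH1: "\<forall>\<^sub>F q in nhds q0. mH (q, q0) = q" and mH2: "\<forall>\<^sub>F q in nhds q0. mH (q0, q) = q"
    and P1: "\<forall>\<^sub>F p in nhds p0. P (p, q0) = q0" and P2: "\<forall>\<^sub>F q in nhds q0. P (p0, q) = q"
    and T1: "\<forall>\<^sub>F q in nhds q0. T (q, p0) = p0" and T2: "\<forall>\<^sub>F p in nhds p0. T (q0, p) = p"
    and B0: "B q0 = p0" and k0: "k q0 = q0"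
    and inv: "\<forall>\<^sub>F q in nhds q0. mH (q, P (B q, k q)) = q0"
    and id: "\<forall>\<^sub>F z in nhds (q0, p0).
      m (B (P (snd z, k (fst z))), T z) = m (snd z, B (k (fst z)))"
  shows "second_derivative T (q0, p0) (u, 0) (0, x) =
    frechet_derivative B (at q0) (second_derivative P (p0, q0) (x, 0) (0, u)) +
    (second_derivative m (p0, p0) (frechet_derivative B (at q0) u, 0) (0, x) -
     second_derivative m (p0, p0) (x, 0) (0, frechet_derivative B (at q0) u))"
proof -
  let ?D = "\<lambda>f a. frechet_derivative f (at a)"
  have at0: "P (p0, q0) = q0" "T (q0, p0) = p0"
    using eventually_nhds_x_imp_x[OF P2] eventually_nhds_x_imp_x[OF T2] by auto
  have Dm: "?D m (p0, p0) (v, w) = v + w" for v w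
    unfolding frechet_derivative_prod[OF tm] frechet_derivative_eventually_cong[OF m1]
      frechet_derivative_eventually_cong[OF m2] by simp
  have DmH: "?D mH (q0, q0) (v, w) = v + w" for v w
    unfolding frechet_derivative_prod[OF tmH] frechet_derivative_eventually_cong[OF mH1]
      frechet_derivative_eventually_cong[OF mH2] by simp
  have DP: "?D P (p0, q0) (v, w) = w" for v w
    unfolding frechet_derivative_prod[OF tP] frechet_derivative_eventually_cong[OF P1]
      frechet_derivative_eventually_cong[OF P2] by simp
  have DT: "?D T (q0, p0) (v, w) = w" for v w
    unfolding frechet_derivative_prod[OF tT] frechet_derivative_eventually_cong[OF T1]
      frechet_derivative_eventually_cong[OF T2] by simp
  interpret DB: bounded_linear "?D B q0"
    by (rule has_derivative_bounded_linear[OF twice_differentiable_has_derivative[OF tB]])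
  interpret Dk: bounded_linear "?D k q0"
    by (rule has_derivative_bounded_linear[OF twice_differentiable_has_derivative[OF tk]])
  interpret DDP: bounded_linear "second_derivative P (p0, q0) (x, 0)"
    by (rule second_derivative_linear_right[OF tP])

  note lin = twice_differentiable_linear[OF bounded_linear_fst] twice_differentiable_linear[OF bounded_linear_snd]
    twice_differentiable_linear[OF bounded_linear_ident]
  \<comment> \<open>Differentiating \<open>h \<star> h\<^sup>\<dagger> = e\<close>: the dependence of \<open>\<Phi>(\<B> h)\<close> on \<open>h\<close> does not contribute, as \<open>\<Phi>(g)\<close> fixes \<open>e\<close>.\<close>
  have Dk: "?D k q0 w = - w" for w
  proof -
    note BK = twice_differentiable_Pair[OF tB tk]
    have "twice_differentiable P (B q0, k q0)" using tP by (simp add: B0 k0)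
    note PBK = twice_differentiable_compose[OF BK(1) this]
    note pair = twice_differentiable_Pair[OF lin(7) PBK(1)]
    have "twice_differentiable mH (q0, P (B q0, k q0))" using tmH by (simp add: B0 k0 at0)
    note c = twice_differentiable_compose(3)[OF pair(1) this]
    have "?D (\<lambda>q. mH (q, P (B q, k q))) q0 w = w + ?D k q0 w"
      unfolding c pair(3) PBK(3) BK(3) lin(9) by (simp add: B0 k0 at0 DmH DP)
    moreover have "?D (\<lambda>q. mH (q, P (B q, k q))) q0 w = 0"
      unfolding frechet_derivative_eventually_cong[OF inv] by simp
    ultimately show ?thesis by (simp add: add_eq_0_iff)
  qed

  \<comment> \<open>The inner functions of the identity, from the inside out; \<open>k\<close> is read as a function of the pair.\<close>
  have tk': "twice_differentiable k (fst (q0, p0))" using tk by simp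
  note K = twice_differentiable_compose[OF lin(1) tk']
  have DK: "?D (\<lambda>z. k (fst z)) (q0, p0) (v, w) = - v" for v w
    unfolding K(3) lin(3) by (simp add: Dk)
  have DDK: "second_derivative (\<lambda>z. k (fst z)) (q0, p0) (u, 0) (0, x) = 0"
    unfolding K(2) lin(2,3) by (simp add: second_derivative_zero_right[OF tk] Dk.zero)

  note S = twice_differentiable_Pair[OF lin(4) K(1)]
  have "twice_differentiable P (snd (q0, p0), k (fst (q0, p0)))" using tP by (simp add: k0)
  note R = twice_differentiable_compose[OF S(1) this]
  have DR: "?D (\<lambda>z. P (snd z, k (fst z))) (q0, p0) (v, w) = - v" for v w
    unfolding R(3) S(3) DK lin(6) by (simp add: k0 DP)
  have DDR: "second_derivative (\<lambda>z. P (snd z, k (fst z))) (q0, p0) (u, 0) (0, x) =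
      - second_derivative P (p0, q0) (x, 0) (0, u)"
  proof -
    have "second_derivative (\<lambda>z. P (snd z, k (fst z))) (q0, p0) (u, 0) (0, x) =
        second_derivative P (p0, q0) (0, - u) (x, 0)"
      unfolding R(2) S(2,3) DK DDK lin(5,6) by (simp add: k0 DP)
    \<comment> \<open>\<open>\<phi>(x)u\<close> differentiates along \<open>H\<close> first and along \<open>G\<close> afterwards, hence the exchange.\<close>
    also have "\<dots> = second_derivative P (p0, q0) (x, 0) (- (0, u))"
      by (subst second_derivative_symmetric[OF tP]) simp
    finally show ?thesis by (simp only: DDP.neg)
  qed

  have "twice_differentiable B (P (snd (q0, p0), k (fst (q0, p0))))" using tB by (simp add: k0 at0)
  note BR = twice_differentiable_compose[OF R(1) this]
  have DBR: "?D (\<lambda>z. B (P (snd z, k (fst z)))) (q0, p0) (v, w) = - ?D B q0 v" for v w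
    unfolding BR(3) DR by (simp add: k0 at0 DB.neg)
  have DDBR: "second_derivative (\<lambda>z. B (P (snd z, k (fst z)))) (q0, p0) (u, 0) (0, x) =
      - ?D B q0 (second_derivative P (p0, q0) (x, 0) (0, u))"
    unfolding BR(2) DR DDR by (simp add: k0 at0 DB.neg second_derivative_zero_right[OF tB])

  note pair1 = twice_differentiable_Pair[OF BR(1) tT]
  have "twice_differentiable m (B (P (snd (q0, p0), k (fst (q0, p0)))), T (q0, p0))"
    using tm by (simp add: B0 k0 at0)
  note left = twice_differentiable_compose(2)[OF pair1(1) this]
  have "twice_differentiable B (k (fst (q0, p0)))" using tB by (simp add: k0)
  note BK = twice_differentiable_compose[OF K(1) this]
  note pair2 = twice_differentiable_Pair[OF lin(4) BK(1)]
  have "twice_differentiable m (snd (q0, p0), B (k (fst (q0, p0))))" using tm by (simp add: B0 k0)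
  note right = twice_differentiable_compose(2)[OF pair2(1) this]
  have "second_derivative (\<lambda>z. m (B (P (snd z, k (fst z))), T z)) (q0, p0) (u, 0) (0, x) =
      second_derivative m (p0, p0) (- ?D B q0 u, 0) (0, x) -
      ?D B q0 (second_derivative P (p0, q0) (x, 0) (0, u)) + second_derivative T (q0, p0) (u, 0) (0, x)"
    unfolding left pair1(2,3) DBR DDBR DT by (simp add: B0 k0 at0 Dm DB.zero)
  moreover have "second_derivative (\<lambda>z. m (snd z, B (k (fst z)))) (q0, p0) (u, 0) (0, x) =
      second_derivative m (p0, p0) (0, - ?D B q0 u) (x, 0)"
    unfolding right pair2(2,3) BK(2,3) DK DDK lin(5,6)
    by (simp add: B0 k0 at0 Dm DB.zero DB.neg second_derivative_zero_right[OF tB])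
  \<comment> \<open>Bring both second derivatives of \<open>m\<close> into the form in which they occur in the bracket.\<close>
  moreover have "second_derivative m (p0, p0) (0, - ?D B q0 u) (x, 0) =
      - second_derivative m (p0, p0) (x, 0) (0, ?D B q0 u)"
    using linear_simps(4)[OF second_derivative_linear_right[OF tm], of "(x, 0)" "(0, ?D B q0 u)"]
    by (subst second_derivative_symmetric[OF tm]) simp
  moreover have "second_derivative m (p0, p0) (- ?D B q0 u, 0) (0, x) =
      - second_derivative m (p0, p0) (?D B q0 u, 0) (0, x)"
    using linear_simps(4)[OF second_derivative_linear_right[OF tm], of "(0, x)" "(?D B q0 u, 0)"]
    by (simp add: second_derivative_symmetric[OF tm, of _ "(0, x)"])
  ultimately show ?thesis
    unfolding twice_differentiable_cong(2)[OF id] by (simp add: algebra_simps)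
qed

section \<open>Maps into manifolds read in a chart\<close>

lemma is_chartD:
  assumes "is_chart c"
  shows "open (fst c)" "open (snd c ` fst c)" "continuous_on (fst c) (snd c)"
    "continuous_on (snd c ` fst c) (chart_inv c)"
    "x \<in> fst c \<Longrightarrow> chart_inv c (snd c x) = x"
    "y \<in> snd c ` fst c \<Longrightarrow> chart_inv c y \<in> fst c"
    "y \<in> snd c ` fst c \<Longrightarrow> snd c (chart_inv c y) = y"
  using assms unfolding is_chart_def homeomorphism_def by auto

text \<open>
  The inverse of a product chart is \<open>inv_into\<close> of the product map, so it is the product of the
  inverses only on the image of the chart.
\<close>

lemma is_chart_prod:
  assumes c: "is_chart c" and d: "is_chart d"
  shows "is_chart (fst c \<times> fst d, map_prod (snd c) (snd d))"
    and "x \<in> fst c \<Longrightarrow> y \<in> fst d \<Longrightarrow>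
      chart_inv (fst c \<times> fst d, map_prod (snd c) (snd d)) (snd c x, snd d y) = (x, y)"
proof -
  let ?e = "(fst c \<times> fst d, map_prod (snd c) (snd d))"
  have inj: "inj_on (map_prod (snd c) (snd d)) (fst c \<times> fst d)"
    by (intro map_prod_inj_on inj_on_inverseI[where g="chart_inv c"] inj_on_inverseI[where g="chart_inv d"]
        is_chartD(5)[OF c] is_chartD(5)[OF d])
  have inv: "chart_inv ?e (snd c x, snd d y) = (x, y)" if "x \<in> fst c" "y \<in> fst d" for x y
    unfolding chart_inv_def using inv_into_f_f[OF inj, of "(x, y)"] that by simp
  show "x \<in> fst c \<Longrightarrow> y \<in> fst d \<Longrightarrow> chart_inv ?e (snd c x, snd d y) = (x, y)" by (rule inv)
  have im: "snd ?e ` fst ?e = (snd c ` fst c) \<times> (snd d ` fst d)" by auto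
  have cont: "continuous_on (fst c \<times> fst d) (map_prod (snd c) (snd d))"
    unfolding map_prod_def case_prod_beta
    by (intro continuous_on_Pair continuous_on_compose2[OF is_chartD(3)[OF c]]
        continuous_on_compose2[OF is_chartD(3)[OF d]] continuous_intros) auto
  have "continuous_on ((snd c ` fst c) \<times> (snd d ` fst d)) (\<lambda>z. (chart_inv c (fst z), chart_inv d (snd z)))"
    by (intro continuous_on_Pair continuous_on_compose2[OF is_chartD(4)[OF c]]
        continuous_on_compose2[OF is_chartD(4)[OF d]] continuous_intros) auto
  then have cont': "continuous_on (snd ?e ` fst ?e) (chart_inv ?e)"
    unfolding im by (rule continuous_on_eq) (auto simp: inv is_chartD(5)[OF c] is_chartD(5)[OF d])
  have inv': "chart_inv ?e (snd ?e z) = z" if "z \<in> fst ?e" for z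
    using that inv by (cases z) auto
  have "homeomorphism (fst ?e) (snd ?e ` fst ?e) (snd ?e) (chart_inv ?e)"
    by (rule homeomorphismI) (use cont cont' inv' in auto)
  moreover have "open (fst ?e)" "open (snd ?e ` fst ?e)"
    unfolding im using c d by (auto intro!: open_Times is_chartD)
  ultimately show "is_chart ?e" unfolding is_chart_def by blast
qed

text \<open>
  Germs of maps from a normed space into a manifold. Continuity is part of the notion: it keeps
  nearby values in the domain of the chart \<open>c\<close>, where \<open>chart_inv c\<close> undoes \<open>snd c\<close>. Composites of such
  germs with smooth maps can be formed on the manifold itself, without coordinates in between.
\<close>

definition C2_at :: "('m::topological_space, 'f::real_normed_vector) chart \<Rightarrow>
    ('e::real_normed_vector \<Rightarrow> 'm) \<Rightarrow> 'e \<Rightarrow> bool"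
  where "C2_at c F a \<longleftrightarrow> filterlim F (nhds (F a)) (nhds a) \<and> F a \<in> fst c \<and>
    twice_differentiable (\<lambda>x. snd c (F x)) a"

lemma C2_at_eventually_in_chart:
  assumes "is_chart c" "C2_at c F a"
  shows "\<forall>\<^sub>F x in nhds a. F x \<in> fst c"
proof -
  have "\<forall>\<^sub>F y in nhds (F a). y \<in> fst c"
    using is_chartD(1)[OF assms(1)] assms(2) by (simp add: C2_at_def eventually_nhds_in_open)
  then show ?thesis using assms(2) unfolding C2_at_def by (auto dest: eventually_compose_filterlim)
qed

lemma C2_at_compose:
  fixes c :: "('m::topological_space, 'e::finite_dim_inner) chart"
    and d :: "('n::topological_space, 'f::real_normed_vector) chart"
  assumes \<phi>: "smooth_map \<A> \<B> \<phi>" and c: "c \<in> \<A>" "is_chart c" and d: "d \<in> \<B>" "is_chart d"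
    and F: "C2_at c F a" and mem: "\<phi> (F a) \<in> fst d"
  shows "C2_at d (\<lambda>x. \<phi> (F x)) a"
proof -
  let ?S = "snd c ` (fst c \<inter> \<phi> -` fst d)"
  have cont: "continuous_on UNIV \<phi>" and sm: "smooth_on ?S (snd d \<circ> \<phi> \<circ> chart_inv c)"
    using \<phi> c d unfolding smooth_map_def by auto
  have Fa: "F a \<in> fst c" using F by (simp add: C2_at_def)
  have "?S = snd c ` fst c \<inter> chart_inv c -` (\<phi> -` fst d)"
    using is_chartD(5,6,7)[OF c(2)] by (auto simp: image_iff)
  moreover have "open (\<phi> -` fst d)"
    using cont is_chartD(1)[OF d(2)] by (simp add: open_vimage)
  ultimately have "open ?S"
    using continuous_on_open_vimage[OF is_chartD(2)[OF c(2)]] is_chartD(4)[OF c(2)]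
    by (metis Int_commute)
  then have tw: "twice_differentiable (snd d \<circ> \<phi> \<circ> chart_inv c) (snd c (F a))"
    by (rule twice_differentiable_of_smooth_on[OF sm]) (use Fa mem in auto)
  have "twice_differentiable (\<lambda>x. snd c (F x)) a" using F by (simp add: C2_at_def)
  from twice_differentiable_compose(1)[OF this tw]
  have "twice_differentiable (\<lambda>x. (snd d \<circ> \<phi> \<circ> chart_inv c) (snd c (F x))) a" .
  moreover have "\<forall>\<^sub>F x in nhds a. (snd d \<circ> \<phi> \<circ> chart_inv c) (snd c (F x)) = snd d (\<phi> (F x))"
    using C2_at_eventually_in_chart[OF c(2) F] by eventually_elim (simp add: is_chartD(5)[OF c(2)])
  ultimately have "twice_differentiable (\<lambda>x. snd d (\<phi> (F x))) a"
    using twice_differentiable_cong(1) by metis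
  moreover have "filterlim (\<lambda>x. \<phi> (F x)) (nhds (\<phi> (F a))) (nhds a)"
  proof -
    have "\<forall>\<^sub>F y in nhds (F a). \<phi> y \<in> U" if "open U" "\<phi> (F a) \<in> U" for U
      using eventually_nhds_in_open[OF open_vimage[OF that(1) cont], of "F a"] that(2) by simp
    then have "filterlim \<phi> (nhds (\<phi> (F a))) (nhds (F a))" by (rule topological_tendstoI)
    moreover have "filterlim F (nhds (F a)) (nhds a)" using F by (simp add: C2_at_def)
    ultimately show ?thesis by (rule filterlim_compose)
  qed
  ultimately show ?thesis using mem by (simp add: C2_at_def)
qed

lemma C2_at_compose2:
  fixes c1 :: "('m::topological_space, 'e::finite_dim_inner) chart"
    and c2 :: "('n::topological_space, 'f::finite_dim_inner) chart"
    and d :: "('k::topological_space, 'g::real_normed_vector) chart"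
  assumes \<phi>: "smooth_map (prod_atlas \<A>1 \<A>2) \<B> (\<lambda>(x, y). \<phi> x y)"
    and c1: "c1 \<in> \<A>1" "is_chart c1" and c2: "c2 \<in> \<A>2" "is_chart c2" and d: "d \<in> \<B>" "is_chart d"
    and F1: "C2_at c1 F1 a" and F2: "C2_at c2 F2 a" and mem: "\<phi> (F1 a) (F2 a) \<in> fst d"
  shows "C2_at d (\<lambda>x. \<phi> (F1 x) (F2 x)) a"
proof -
  let ?c = "(fst c1 \<times> fst c2, map_prod (snd c1) (snd c2))"
  have "?c \<in> prod_atlas \<A>1 \<A>2" using c1 c2 unfolding prod_atlas_def by blast
  moreover have "is_chart ?c" by (rule is_chart_prod(1)[OF c1(2) c2(2)])
  moreover have "C2_at ?c (\<lambda>x. (F1 x, F2 x)) a"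
    using F1 F2 unfolding C2_at_def by (auto intro!: tendsto_Pair twice_differentiable_Pair(1))
  ultimately show ?thesis
    using C2_at_compose[OF \<phi> _ _ d, of ?c "\<lambda>x. (F1 x, F2 x)" a] mem by simp
qed

lemma C2_at_chart_inv:
  assumes c: "is_chart c" and L: "twice_differentiable L a" "L a = snd c p" "p \<in> fst c"
  shows "C2_at c (\<lambda>x. chart_inv c (L x)) a"
proof -
  have La: "L a \<in> snd c ` fst c" using L by simp
  have lim: "filterlim L (nhds (L a)) (nhds a)"
    using has_derivative_continuous[OF twice_differentiable_has_derivative[OF L(1)]]
    by (simp add: isCont_def tendsto_at_iff_tendsto_nhds)
  have "\<forall>\<^sub>F x in nhds a. L x \<in> snd c ` fst c"
    by (rule eventually_compose_filterlim[OF eventually_nhds_in_open[OF is_chartD(2)[OF c] La] lim])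
  then have "\<forall>\<^sub>F x in nhds a. snd c (chart_inv c (L x)) = L x"
    by eventually_elim (rule is_chartD(7)[OF c])
  then have "twice_differentiable (\<lambda>x. snd c (chart_inv c (L x))) a"
    using L(1) by (simp add: twice_differentiable_cong(1))
  moreover have "filterlim (\<lambda>x. chart_inv c (L x)) (nhds (chart_inv c (L a))) (nhds a)"
  proof (rule filterlim_compose[OF _ lim])
    show "filterlim (chart_inv c) (nhds (chart_inv c (L a))) (nhds (L a))"
      using is_chartD(2,4)[OF c] La
      by (metis continuous_on_eq_continuous_at isCont_def tendsto_at_iff_tendsto_nhds)
  qed
  ultimately show ?thesis using L is_chartD(6)[OF c La] by (simp add: C2_at_def)
qed

lemma chart_at_works:
  assumes "smooth_atlas \<A>"
  shows "chart_at \<A> p \<in> \<A>" "p \<in> fst (chart_at \<A> p)" "is_chart (chart_at \<A> p)"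
proof -
  have "\<exists>c. c \<in> \<A> \<and> p \<in> fst c" using assms unfolding smooth_atlas_def by blast
  then have "chart_at \<A> p \<in> \<A> \<and> p \<in> fst (chart_at \<A> p)"
    unfolding chart_at_def by (rule someI_ex)
  with assms show "chart_at \<A> p \<in> \<A>" "p \<in> fst (chart_at \<A> p)" "is_chart (chart_at \<A> p)"
    unfolding smooth_atlas_def by auto
qed

lemma chart_at_vec_atlas: "chart_at vec_atlas p = (UNIV, id)"
  unfolding chart_at_def vec_atlas_def by (rule some_equality) auto

section \<open>The algebra of the action\<close>

context
  fixes G :: "('g::{t2_space,second_countable_topology}, 'e::finite_dim_inner) lie_struct"
    and H :: "('h::{t2_space,second_countable_topology}, 'f::finite_dim_inner) lie_struct"
    and \<Phi> :: "'g \<Rightarrow> 'h \<Rightarrow> 'h" and \<B> :: "'h \<Rightarrow> 'g"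
  assumes G: "lie_group G" and H: "lie_group H" and act: "lie_action G H \<Phi>"
    and RB: "rel_rota_baxter G H \<Phi> \<B>"
begin

interpretation G: group G using G by (simp add: lie_group_def)
interpretation H: group H using H by (simp add: lie_group_def)

lemma carriers [simp]: "carrier G = UNIV" "carrier H = UNIV"
  using G H by (simp_all add: lie_group_def)

lemma action_compose: "\<Phi> (a \<otimes>\<^bsub>G\<^esub> b) h = \<Phi> a (\<Phi> b h)"
  using act by (simp add: lie_action_def hom_def lie_aut_def)

lemma action_iso: "\<Phi> g \<in> iso H H"
  using act by (auto simp: lie_action_def hom_def lie_aut_def)

lemma action_unit [simp]: "\<Phi> \<one>\<^bsub>G\<^esub> h = h"
proof -
  have "inj (\<Phi> \<one>\<^bsub>G\<^esub>)" using action_iso[of "\<one>\<^bsub>G\<^esub>"] by (simp add: iso_def bij_betw_def)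
  moreover have "\<Phi> \<one>\<^bsub>G\<^esub> (\<Phi> \<one>\<^bsub>G\<^esub> h) = \<Phi> \<one>\<^bsub>G\<^esub> h" using action_compose[of "\<one>\<^bsub>G\<^esub>" "\<one>\<^bsub>G\<^esub>" h] by simp
  ultimately show ?thesis by (simp add: inj_eq)
qed

lemma action_fixes_unit [simp]: "\<Phi> g \<one>\<^bsub>H\<^esub> = \<one>\<^bsub>H\<^esub>"
proof -
  have "\<Phi> g \<in> hom H H" using action_iso[of g] by (simp add: iso_def)
  then show ?thesis by (rule hom_one[OF _ H.is_group H.is_group])
qed

lemma operator_unit [simp]: "\<B> \<one>\<^bsub>H\<^esub> = \<one>\<^bsub>G\<^esub>"
proof -
  have "\<B> \<one>\<^bsub>H\<^esub> \<otimes>\<^bsub>G\<^esub> \<B> \<one>\<^bsub>H\<^esub> = \<B> \<one>\<^bsub>H\<^esub>"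
    using RB by (simp add: rel_rota_baxter_def)
  then show ?thesis by (simp add: G.l_cancel_one)
qed

lemma dagger_unit [simp]: "dagger G H \<Phi> \<B> \<one>\<^bsub>H\<^esub> = \<one>\<^bsub>H\<^esub>"
  by (simp add: dagger_def)

text \<open>
  Differentiated at the unit, this equation of the descendent group gives \<open>h \<mapsto> h\<^sup>\<dagger>\<close> the
  derivative \<open>-1\<close> there.
\<close>

lemma dagger_inverse: "h \<otimes>\<^bsub>H\<^esub> \<Phi> (\<B> h) (dagger G H \<Phi> \<B> h) = \<one>\<^bsub>H\<^esub>"
  by (simp add: dagger_def flip: action_compose)

lemma Theta_unit_left [simp]: "Theta G H \<Phi> \<B> \<one>\<^bsub>H\<^esub> g = g"
  by (simp add: Theta_def)

lemma Theta_fixes_unit [simp]: "Theta G H \<Phi> \<B> h \<one>\<^bsub>G\<^esub> = \<one>\<^bsub>G\<^esub>"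
  by (simp add: Theta_def)

text \<open>
  Moving the inverse to the other side leaves an equation between products, so that differentiation
  never meets the derivative of the inversion of \<open>G\<close>.
\<close>

lemma Theta_factorization:
  "\<B> (\<Phi> g (dagger G H \<Phi> \<B> h)) \<otimes>\<^bsub>G\<^esub> Theta G H \<Phi> \<B> h g = g \<otimes>\<^bsub>G\<^esub> \<B> (dagger G H \<Phi> \<B> h)"
  by (simp add: Theta_def G.m_assoc flip: G.m_assoc[of "\<B> (\<Phi> g (dagger G H \<Phi> \<B> h))"])

section \<open>Tangent maps at the units\<close>

text \<open>
  All maps involved send units to units, so a single chart of each group suffices. With \<open>P\<close>, \<open>T\<close>,
  \<open>m\<close> for the action, for \<open>\<Theta>\<close> and for the multiplication of \<open>G\<close> in these charts, \<open>\<phi>(x)u\<close>, the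
  differential of \<open>\<Theta>\<close> and the bracket are mixed second derivatives of \<open>P\<close>, \<open>T\<close> and \<open>m\<close>. The
  coordinate lemma relates these three; its hypotheses hold near the base points because the values
  of continuous maps stay in the charts there.
\<close>

lemma differentiated_Theta:
  "blinfun_apply (tangent_map (atlas H) vec_atlas (Theta_lin G H \<Phi> \<B>) \<one>\<^bsub>H\<^esub> u) x =
    tangent_map (atlas H) (atlas G) \<B> \<one>\<^bsub>H\<^esub> (blinfun_apply (diff_action G H \<Phi> x) u) +
    lie_bracket G (tangent_map (atlas H) (atlas G) \<B> \<one>\<^bsub>H\<^esub> u) x"
proof -
  define cG where "cG = chart_at (atlas G) \<one>\<^bsub>G\<^esub>"
  define cH where "cH = chart_at (atlas H) \<one>\<^bsub>H\<^esub>"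
  define p0 where "p0 = snd cG \<one>\<^bsub>G\<^esub>"
  define q0 where "q0 = snd cH \<one>\<^bsub>H\<^esub>"
  let ?iG = "chart_inv cG" and ?iH = "chart_inv cH"
  let ?dag = "dagger G H \<Phi> \<B>" and ?Th = "Theta G H \<Phi> \<B>"
  define m where "m = (\<lambda>z. snd cG (?iG (fst z) \<otimes>\<^bsub>G\<^esub> ?iG (snd z)))"
  define mH where "mH = (\<lambda>z. snd cH (?iH (fst z) \<otimes>\<^bsub>H\<^esub> ?iH (snd z)))"
  define P where "P = (\<lambda>z. snd cH (\<Phi> (?iG (fst z)) (?iH (snd z))))"
  define B where "B = (\<lambda>q. snd cG (\<B> (?iH q)))"
  define k where "k = (\<lambda>q. snd cH (?dag (?iH q)))"
  define T where "T = (\<lambda>z. snd cG (?Th (?iH (fst z)) (?iG (snd z))))"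

  have smG: "smooth_map (prod_atlas (atlas G) (atlas G)) (atlas G) (\<lambda>(a, b). a \<otimes>\<^bsub>G\<^esub> b)"
    "smooth_map (atlas G) (atlas G) (\<lambda>a. inv\<^bsub>G\<^esub> a)" and aG: "smooth_atlas (atlas G)"
    using G by (auto simp: lie_group_def)
  have smH: "smooth_map (prod_atlas (atlas H) (atlas H)) (atlas H) (\<lambda>(a, b). a \<otimes>\<^bsub>H\<^esub> b)"
    "smooth_map (atlas H) (atlas H) (\<lambda>a. inv\<^bsub>H\<^esub> a)" and aH: "smooth_atlas (atlas H)"
    using H by (auto simp: lie_group_def)
  have smP: "smooth_map (prod_atlas (atlas G) (atlas H)) (atlas H) (\<lambda>(g, h). \<Phi> g h)"
    using act by (simp add: lie_action_def)
  have smB: "smooth_map (atlas H) (atlas G) \<B>" using RB by (simp add: rel_rota_baxter_def)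
  have cG: "cG \<in> atlas G" "is_chart cG" and oneG: "\<one>\<^bsub>G\<^esub> \<in> fst cG"
    using chart_at_works[OF aG] by (simp_all add: cG_def)
  have cH: "cH \<in> atlas H" "is_chart cH" and oneH: "\<one>\<^bsub>H\<^esub> \<in> fst cH"
    using chart_at_works[OF aH] by (simp_all add: cH_def)
  have iG0 [simp]: "?iG p0 = \<one>\<^bsub>G\<^esub>" unfolding p0_def by (rule is_chartD(5)[OF cG(2) oneG])
  have iH0 [simp]: "?iH q0 = \<one>\<^bsub>H\<^esub>" unfolding q0_def by (rule is_chartD(5)[OF cH(2) oneH])
  have invG: "?iG (snd cG g) = g" if "g \<in> fst cG" for g by (rule is_chartD(5)[OF cG(2) that])
  have invH: "?iH (snd cH h) = h" if "h \<in> fst cH" for h by (rule is_chartD(5)[OF cH(2) that])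
  have evG: "\<forall>\<^sub>F p in nhds p0. snd cG (?iG p) = p"
  proof -
    have "\<forall>\<^sub>F p in nhds p0. p \<in> snd cG ` fst cG"
      using oneG by (intro eventually_nhds_in_open is_chartD(2)[OF cG(2)]) (simp add: p0_def)
    then show ?thesis by eventually_elim (rule is_chartD(7)[OF cG(2)])
  qed
  have evH: "\<forall>\<^sub>F q in nhds q0. snd cH (?iH q) = q"
  proof -
    have "\<forall>\<^sub>F q in nhds q0. q \<in> snd cH ` fst cH"
      using oneH by (intro eventually_nhds_in_open is_chartD(2)[OF cH(2)]) (simp add: q0_def)
    then show ?thesis by eventually_elim (rule is_chartD(7)[OF cH(2)])
  qed

  note tw = twice_differentiable_linear(1)[OF bounded_linear_fst]
    twice_differentiable_linear(1)[OF bounded_linear_snd]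
    twice_differentiable_linear(1)[OF bounded_linear_ident]
  \<comment> \<open>The coordinate projections, as germs of maps from coordinate space into the groups; the names record the two factors and the position.\<close>
  have GG1: "C2_at cG (\<lambda>z. ?iG (fst z)) (p0, p0)" and GG2: "C2_at cG (\<lambda>z. ?iG (snd z)) (p0, p0)"
    and HH1: "C2_at cH (\<lambda>z. ?iH (fst z)) (q0, q0)" and HH2: "C2_at cH (\<lambda>z. ?iH (snd z)) (q0, q0)"
    and GH1: "C2_at cG (\<lambda>z. ?iG (fst z)) (p0, q0)" and GH2: "C2_at cH (\<lambda>z. ?iH (snd z)) (p0, q0)"
    and HG1: "C2_at cH (\<lambda>z. ?iH (fst z)) (q0, p0)" and HG2: "C2_at cG (\<lambda>z. ?iG (snd z)) (q0, p0)"
    and H1: "C2_at cH (\<lambda>q. ?iH q) q0"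
    by (rule C2_at_chart_inv[OF cG(2) _ _ oneG] C2_at_chart_inv[OF cH(2) _ _ oneH];
        simp add: tw p0_def q0_def)+
  note multG = C2_at_compose2[OF smG(1) cG cG cG] and invsG = C2_at_compose[OF smG(2) cG cG]
    and multH = C2_at_compose2[OF smH(1) cH cH cH] and invsH = C2_at_compose[OF smH(2) cH cH]
    and actC = C2_at_compose2[OF smP cG cH cH] and opC = C2_at_compose[OF smB cH cG]
  have dagC: "C2_at cH (\<lambda>z. ?dag (F z)) a" if "C2_at cH F a" "F a = \<one>\<^bsub>H\<^esub>" for F :: "'z::real_normed_vector \<Rightarrow> 'h" and a
    unfolding dagger_def
    by (intro actC invsG invsH opC that(1)) (simp_all add: that(2) oneG oneH)
  have ThC: "C2_at cG (\<lambda>z. ?Th (F z) (F' z)) a"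
    if "C2_at cH F a" "F a = \<one>\<^bsub>H\<^esub>" "C2_at cG F' a" "F' a = \<one>\<^bsub>G\<^esub>"
    for F :: "'z::real_normed_vector \<Rightarrow> 'h" and F' a
    unfolding Theta_def
    by (intro multG invsG opC actC dagC that) (simp_all add: that(2,4) oneG oneH)

  have C2_tw: "twice_differentiable (\<lambda>z. snd c (F z)) a" if "C2_at c F a"
    for c :: "('z::topological_space, 'y::real_normed_vector) chart"
      and F :: "'w::real_normed_vector \<Rightarrow> 'z" and a
    using that by (simp add: C2_at_def)
  have tm: "twice_differentiable m (p0, p0)" unfolding m_def
    by (intro C2_tw multG GG1 GG2) (simp add: oneG)
  have tmH: "twice_differentiable mH (q0, q0)" unfolding mH_def
    by (intro C2_tw multH HH1 HH2) (simp add: oneH)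
  have tP: "twice_differentiable P (p0, q0)" unfolding P_def
    by (intro C2_tw actC GH1 GH2) (simp add: oneH)
  have tB: "twice_differentiable B q0" unfolding B_def
    by (intro C2_tw opC H1) (simp add: oneG)
  have tk: "twice_differentiable k q0" unfolding k_def
    by (intro C2_tw dagC H1) simp
  have tT: "twice_differentiable T (q0, p0)" unfolding T_def
    by (intro C2_tw ThC HG1 HG2) simp_all

  have inv: "\<forall>\<^sub>F q in nhds q0. mH (q, P (B q, k q)) = q0"
  proof -
    have opB: "C2_at cG (\<lambda>q. \<B> (?iH q)) q0" by (intro opC H1) (simp add: oneG)
    have dag: "C2_at cH (\<lambda>q. ?dag (?iH q)) q0" by (intro dagC H1) simp
    have "C2_at cH (\<lambda>q. \<Phi> (\<B> (?iH q)) (?dag (?iH q))) q0"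
      by (intro actC opB dag) (simp add: oneH)
    note ev = C2_at_eventually_in_chart[OF cG(2) opB] C2_at_eventually_in_chart[OF cH(2) dag]
      C2_at_eventually_in_chart[OF cH(2) this]
    show ?thesis using ev
      by eventually_elim (simp add: mH_def P_def B_def k_def invG invH dagger_inverse q0_def)
  qed
  have id: "\<forall>\<^sub>F z in nhds (q0, p0). m (B (P (snd z, k (fst z))), T z) = m (snd z, B (k (fst z)))"
  proof -
    have dag: "C2_at cH (\<lambda>z. ?dag (?iH (fst z))) (q0, p0)" by (intro dagC HG1) simp
    have acted: "C2_at cH (\<lambda>z. \<Phi> (?iG (snd z)) (?dag (?iH (fst z)))) (q0, p0)"
      by (intro actC HG2 dag) (simp add: oneH)
    have opA: "C2_at cG (\<lambda>z. \<B> (\<Phi> (?iG (snd z)) (?dag (?iH (fst z))))) (q0, p0)"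
      by (intro opC acted) (simp add: oneG)
    have opD: "C2_at cG (\<lambda>z. \<B> (?dag (?iH (fst z)))) (q0, p0)"
      by (intro opC dag) (simp add: oneG)
    have Th: "C2_at cG (\<lambda>z. ?Th (?iH (fst z)) (?iG (snd z))) (q0, p0)"
      by (intro ThC HG1 HG2) simp_all
    note ev = C2_at_eventually_in_chart[OF cH(2) dag] C2_at_eventually_in_chart[OF cH(2) acted]
      C2_at_eventually_in_chart[OF cG(2) opA] C2_at_eventually_in_chart[OF cG(2) opD]
      C2_at_eventually_in_chart[OF cG(2) Th]
    show ?thesis using ev
      by eventually_elim (simp add: m_def P_def B_def k_def T_def invG invH Theta_factorization)
  qed
  have m1: "\<forall>\<^sub>F p in nhds p0. m (p, p0) = p" and m2: "\<forall>\<^sub>F p in nhds p0. m (p0, p) = p"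
    using evG by (auto simp: m_def)
  have mH1: "\<forall>\<^sub>F q in nhds q0. mH (q, q0) = q" and mH2: "\<forall>\<^sub>F q in nhds q0. mH (q0, q) = q"
    using evH by (auto simp: mH_def)
  have P1: "\<forall>\<^sub>F p in nhds p0. P (p, q0) = q0" by (simp add: P_def q0_def[symmetric])
  have P2: "\<forall>\<^sub>F q in nhds q0. P (p0, q) = q" using evH by (simp add: P_def)
  have T1: "\<forall>\<^sub>F q in nhds q0. T (q, p0) = p0" by (simp add: T_def p0_def[symmetric])
  have T2: "\<forall>\<^sub>F p in nhds p0. T (q0, p) = p" using evG by (simp add: T_def)
  have B0: "B q0 = p0" and k0: "k q0 = q0" by (simp_all add: B_def k_def p0_def q0_def[symmetric])

  have dB: "tangent_map (atlas H) (atlas G) \<B> \<one>\<^bsub>H\<^esub> = frechet_derivative B (at q0)"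
    by (simp add: tangent_map_def deriv_in_charts_def B_def o_def q0_def flip: cG_def cH_def)

  have dphi: "blinfun_apply (diff_action G H \<Phi> x) u = second_derivative P (p0, q0) (x, 0) (0, u)"
  proof -
    have "aut_deriv H \<Phi> (?iG p) = Blinfun (frechet_derivative (\<lambda>q. P (p, q)) (at q0))" for p
      by (simp add: aut_deriv_def tangent_map_def deriv_in_charts_def P_def o_def q0_def flip: cH_def)
    then have "diff_action G H \<Phi> =
        frechet_derivative (\<lambda>p. Blinfun (frechet_derivative (\<lambda>q. P (p, q)) (at q0))) (at p0)"
      by (simp add: diff_action_def tangent_map_def deriv_in_charts_def chart_at_vec_atlas o_def p0_def
          flip: cG_def)
    also have "\<dots> = (\<lambda>x. Blinfun (\<lambda>v. second_derivative P (p0, q0) (x, 0) (0, v)))"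
      by (rule frechet_derivative_at[OF has_derivative_partial_derivative(1)[OF tP], symmetric])
    finally show ?thesis
      by (simp add: bounded_linear_Blinfun_apply has_derivative_partial_derivative(3)[OF tP])
  qed

  have dTheta: "blinfun_apply (tangent_map (atlas H) vec_atlas (Theta_lin G H \<Phi> \<B>) \<one>\<^bsub>H\<^esub> u) x =
      second_derivative T (q0, p0) (u, 0) (0, x)"
  proof -
    have "Theta_lin G H \<Phi> \<B> (?iH q) = Blinfun (frechet_derivative (\<lambda>p. T (q, p)) (at p0))" for q
      by (simp add: Theta_lin_def tangent_map_def deriv_in_charts_def T_def o_def p0_def flip: cG_def)
    then have "tangent_map (atlas H) vec_atlas (Theta_lin G H \<Phi> \<B>) \<one>\<^bsub>H\<^esub> =
        frechet_derivative (\<lambda>q. Blinfun (frechet_derivative (\<lambda>p. T (q, p)) (at p0))) (at q0)"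
      by (simp add: tangent_map_def deriv_in_charts_def chart_at_vec_atlas o_def q0_def flip: cH_def)
    also have "\<dots> = (\<lambda>u. Blinfun (\<lambda>v. second_derivative T (q0, p0) (u, 0) (0, v)))"
      by (rule frechet_derivative_at[OF has_derivative_partial_derivative(1)[OF tT], symmetric])
    finally show ?thesis
      by (simp add: bounded_linear_Blinfun_apply has_derivative_partial_derivative(3)[OF tT])
  qed

  have bracket: "lie_bracket G v w =
      second_derivative m (p0, p0) (v, 0) (0, w) - second_derivative m (p0, p0) (w, 0) (0, v)" for v w
  proof -
    \<comment> \<open>The value at the unit is \<open>v\<close>, so the bracket of vector fields becomes the antisymmetrized mixed derivative of \<open>m\<close>.\<close>
    have field: "left_inv_field G v = (\<lambda>q. frechet_derivative (\<lambda>p. m (q, p)) (at p0) v)" for v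
      by (rule ext) (simp add: left_inv_field_def Let_def deriv_in_charts_def m_def o_def p0_def flip: cG_def)
    have "frechet_derivative (left_inv_field G v) (at p0) w = second_derivative m (p0, p0) (w, 0) (0, v)" for v w
      unfolding field
      by (simp flip: frechet_derivative_at[OF has_derivative_partial_derivative_apply[OF tm]])
    moreover have "left_inv_field G v p0 = v" for v
      unfolding field frechet_derivative_eventually_cong[OF m2] by simp
    ultimately show ?thesis
      by (simp add: lie_bracket_def vector_field_bracket_def flip: cG_def p0_def)
  qed

  show ?thesis
    unfolding dB dphi dTheta bracket
    by (rule mixed_derivative_of_local_identity[OF tm tmH tP tB tk tT m1 m2 mH1 mH2 P1 P2 T1 T2 B0 k0 inv id])
qed

end

theorem proposition4p6:
  fixes G :: "('g::{t2_space,second_countable_topology}, 'e::finite_dim_inner) lie_struct"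
    and H :: "('h::{t2_space,second_countable_topology}, 'f::finite_dim_inner) lie_struct"
    and \<Phi> :: "'g \<Rightarrow> 'h \<Rightarrow> 'h"
    and \<B> :: "'h \<Rightarrow> 'g"
  assumes "lie_group G" and "lie_group H"
    and "lie_action G H \<Phi>"
    and "rel_rota_baxter G H \<Phi> \<B>"
  shows "let B = tangent_map (atlas H) (atlas G) \<B> \<one>\<^bsub>H\<^esub>;
             \<phi> = diff_action G H \<Phi>;
             D = descendent H \<Phi> \<B>;
             dTheta = tangent_map (atlas D) vec_atlas (Theta_lin G H \<Phi> \<B>) \<one>\<^bsub>D\<^esub>
         in \<forall>x u. blinfun_apply (dTheta u) x = B (blinfun_apply (\<phi> x) u) + lie_bracket G (B u) x"
  by (simp add: Let_def descendent_def differentiated_Theta[OF assms])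

end
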